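(* There is a polynomial-time approximation algorithm for Generalized Max-Dicut($T$) that outputs a labeling whose value is at least $\frac14+\Omega(\frac1T)$ times the optimum (the constant in $\Omega$ being absolute).
   Context: Generalized Max-Dicut($T$), for a positive integer $T$: an instance is a directed graph $D=(V,A)$ with edge labels $l_A:A\to\{1,\dots,T\}$ and weights $w:A\to\mathbb{R}^+$ summing to $1$; a labeling $l_V:V\to\{0,\dots,T\}$ satisfies edge $(u,v)$ iff $l_V(u)=0$ and $l_V(v)=l_A(u,v)$; the value of $l_V$ is the total weight of satisfied edges and $\mathsf{Opt}$ is the maximum value. *)

theory Defs
  imports
    Complex_Main
    "HOL-Library.FuncSet"
    "HOL-Library.Discrete_Functions"
    "HOL-Computational_Algebra.Polynomial"
    "Graph_Theory.Pair_Digraph"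
begin

section \<open>Generalized Max-Dicut\<close>

text \<open>
  Loops are allowed (no labeling satisfies one), as are isolated vertices.
\<close>

definition gmd_instance ::
    "nat \<Rightarrow> 'v pair_pre_digraph \<Rightarrow> ('v \<times> 'v \<Rightarrow> nat) \<Rightarrow> ('v \<times> 'v \<Rightarrow> real) \<Rightarrow> bool" where
  "gmd_instance T D lA w \<longleftrightarrow>
     pair_fin_digraph D \<and>
     (\<forall>e \<in> parcs D. lA e \<in> {1..T}) \<and>
     (\<forall>e \<in> parcs D. w e > 0) \<and>
     (\<Sum>e \<in> parcs D. w e) = 1"

definition labelings :: "nat \<Rightarrow> 'v pair_pre_digraph \<Rightarrow> ('v \<Rightarrow> nat) set" where
  "labelings T D = (pverts D \<rightarrow> {0..T})"

definition satisfied :: "('v \<times> 'v \<Rightarrow> nat) \<Rightarrow> ('v \<Rightarrow> nat) \<Rightarrow> 'v \<times> 'v \<Rightarrow> bool" where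
  "satisfied lA lV = (\<lambda>(u, v). lV u = 0 \<and> lV v = lA (u, v))"

definition labeling_value ::
    "'v pair_pre_digraph \<Rightarrow> ('v \<times> 'v \<Rightarrow> nat) \<Rightarrow> ('v \<times> 'v \<Rightarrow> real) \<Rightarrow> ('v \<Rightarrow> nat) \<Rightarrow> real" where
  "labeling_value D lA w lV = (\<Sum>e \<in> {e \<in> parcs D. satisfied lA lV e}. w e)"

definition gmd_opt ::
    "nat \<Rightarrow> 'v pair_pre_digraph \<Rightarrow> ('v \<times> 'v \<Rightarrow> nat) \<Rightarrow> ('v \<times> 'v \<Rightarrow> real) \<Rightarrow> real" where
  "gmd_opt T D lA w = Max (labeling_value D lA w ` labelings T D)"

text \<open>
  A labeling is unconstrained outside the vertex set, so the set of labelings may be infinite;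
  the set of values is nevertheless finite and non-empty, and the maximum is attained.
\<close>

lemma gmd_opt_attained:
  assumes "gmd_instance T D lA w"
  shows "\<exists>lV \<in> labelings T D. labeling_value D lA w lV = gmd_opt T D lA w"
    and "\<And>lV. lV \<in> labelings T D \<Longrightarrow> labeling_value D lA w lV \<le> gmd_opt T D lA w"
proof -
  have "finite (parcs D)"
    using assms by (simp add: gmd_instance_def pair_fin_digraph.pair_finite_arcs)
  moreover have "labeling_value D lA w ` labelings T D \<subseteq> sum w ` Pow (parcs D)"
    unfolding labeling_value_def by blast
  ultimately have fin: "finite (labeling_value D lA w ` labelings T D)"
    by (meson finite_Pow_iff finite_imageI finite_subset)
  have "(\<lambda>_. 0) \<in> labelings T D"
    by (simp add: labelings_def)
  then have "labeling_value D lA w ` labelings T D \<noteq> {}"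
    by blast
  with fin have "gmd_opt T D lA w \<in> labeling_value D lA w ` labelings T D"
    unfolding gmd_opt_def by (rule Max_in)
  then show "\<exists>lV \<in> labelings T D. labeling_value D lA w lV = gmd_opt T D lA w"
    by auto
  show "labeling_value D lA w lV \<le> gmd_opt T D lA w" if "lV \<in> labelings T D" for lV
    unfolding gmd_opt_def using fin that by simp
qed


section \<open>Random access machines with logarithmic cost\<close>

text \<open>
  The machine model is the random access machine of Aho, Hopcroft and Ullman under the logarithmic
  cost criterion, with structured control flow instead of jumps (a jump program is a single
  while loop that branches on a program counter kept in a register). Polynomial time
  on it coincides with polynomial time on Turing machines. There are infinitely many
  registers holding natural numbers, all initially 0; the input is a list of naturals in a
  separate read-only random access store. Subtraction is truncated, division rounds down,
  and division by 0 yields 0.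
\<close>

datatype operand =
    Const nat  \<comment> \<open>the number itself\<close>
  | Reg nat    \<comment> \<open>the contents of a register\<close>
  | Ind nat    \<comment> \<open>the contents of the register whose address is in the given register\<close>
  | Inp nat    \<comment> \<open>the input word whose index is in the given register; 0 beyond the input\<close>

datatype target = ToReg nat | ToInd nat

datatype arith = Add | Sub | Mul | Div

datatype com =
    Assign target arith operand operand
  | Seq com com
  | IfLess operand operand com com
  | WhileLess operand operand com

type_synonym store = "nat \<Rightarrow> nat"

definition input_word :: "nat list \<Rightarrow> nat \<Rightarrow> nat" where
  "input_word xs i = (if i < length xs then xs ! i else 0)"

fun operand_val :: "nat list \<Rightarrow> store \<Rightarrow> operand \<Rightarrow> nat" where
  "operand_val xs s (Const k) = k"
| "operand_val xs s (Reg i) = s i"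
| "operand_val xs s (Ind i) = s (s i)"
| "operand_val xs s (Inp i) = input_word xs (s i)"

fun target_addr :: "store \<Rightarrow> target \<Rightarrow> nat" where
  "target_addr s (ToReg i) = i"
| "target_addr s (ToInd i) = s i"

fun arith_val :: "arith \<Rightarrow> nat \<Rightarrow> nat \<Rightarrow> nat" where
  "arith_val Add a b = a + b"
| "arith_val Sub a b = a - b"
| "arith_val Mul a b = a * b"
| "arith_val Div a b = a div b"

text \<open>The number of binary digits; the number 0 has one digit.\<close>

definition bits :: "nat \<Rightarrow> nat" where
  "bits n = floor_log n + 1"

text \<open>Every number and every address that is touched is charged its binary length.\<close>

fun operand_cost :: "nat list \<Rightarrow> store \<Rightarrow> operand \<Rightarrow> nat" where
  "operand_cost xs s (Const k) = bits k"
| "operand_cost xs s (Reg i) = bits i + bits (s i)"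
| "operand_cost xs s (Ind i) = bits i + bits (s i) + bits (s (s i))"
| "operand_cost xs s (Inp i) = bits i + bits (s i) + bits (input_word xs (s i))"

fun target_cost :: "store \<Rightarrow> target \<Rightarrow> nat" where
  "target_cost s (ToReg i) = bits i"
| "target_cost s (ToInd i) = bits i + bits (s i)"

text \<open>
  \<open>exec xs c s t s'\<close>: on input \<open>xs\<close>, the program \<open>c\<close> started in store \<open>s\<close> halts after
  time \<open>t\<close> in store \<open>s'\<close>. A program that does not halt has no such \<open>t\<close> and \<open>s'\<close>.
\<close>

inductive exec :: "nat list \<Rightarrow> com \<Rightarrow> store \<Rightarrow> nat \<Rightarrow> store \<Rightarrow> bool" for xs :: "nat list" where
  Assign: "r = arith_val f (operand_val xs s a) (operand_val xs s b) \<Longrightarrow>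
    exec xs (Assign d f a b) s
      (operand_cost xs s a + operand_cost xs s b + target_cost s d + bits r)
      (s(target_addr s d := r))"
| Seq: "exec xs c1 s t1 s1 \<Longrightarrow> exec xs c2 s1 t2 s2 \<Longrightarrow> exec xs (Seq c1 c2) s (t1 + t2) s2"
| IfTrue: "operand_val xs s a < operand_val xs s b \<Longrightarrow> exec xs c1 s t s' \<Longrightarrow>
    exec xs (IfLess a b c1 c2) s (operand_cost xs s a + operand_cost xs s b + t) s'"
| IfFalse: "\<not> operand_val xs s a < operand_val xs s b \<Longrightarrow> exec xs c2 s t s' \<Longrightarrow>
    exec xs (IfLess a b c1 c2) s (operand_cost xs s a + operand_cost xs s b + t) s'"
| WhileTrue: "operand_val xs s a < operand_val xs s b \<Longrightarrow> exec xs c s t1 s1 \<Longrightarrow>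
    exec xs (WhileLess a b c) s1 t2 s2 \<Longrightarrow>
    exec xs (WhileLess a b c) s (operand_cost xs s a + operand_cost xs s b + t1 + t2) s2"
| WhileFalse: "\<not> operand_val xs s a < operand_val xs s b \<Longrightarrow>
    exec xs (WhileLess a b c) s (operand_cost xs s a + operand_cost xs s b) s"

inductive_cases exec_AssignE: "exec xs (Assign d f a b) s t s'"
  and exec_SeqE: "exec xs (Seq c1 c2) s t s'"
  and exec_IfE: "exec xs (IfLess a b c1 c2) s t s'"
  and exec_WhileE: "exec xs (WhileLess a b c) s t s'"

lemma exec_deterministic:
  "exec xs c s t s1 \<Longrightarrow> exec xs c s t' s2 \<Longrightarrow> t' = t \<and> s2 = s1"
proof (induction arbitrary: t' s2 rule: exec.induct)
  case (Assign r f s a b d)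
  from Assign.prems show ?case by (rule exec_AssignE) (simp add: Assign.hyps)
next
  case (Seq c1 s t1 s1 c2 t2 s3)
  from Seq.prems show ?case by (rule exec_SeqE) (metis Seq.IH)
next
  case (IfTrue s a b c1 t s' c2)
  from IfTrue.prems show ?case by (rule exec_IfE) (use IfTrue.IH IfTrue.hyps in blast)+
next
  case (IfFalse s a b c2 t s' c1)
  from IfFalse.prems show ?case by (rule exec_IfE) (use IfFalse.IH IfFalse.hyps in blast)+
next
  case (WhileTrue s a b c t1 s1 t2 s3)
  from WhileTrue.prems show ?case
  proof (rule exec_WhileE)
    fix u1 r u2
    assume t': "t' = operand_cost xs s a + operand_cost xs s b + u1 + u2"
      and 1: "exec xs c s u1 r" and 2: "exec xs (WhileLess a b c) r u2 s2"
    from 1 have "u1 = t1 \<and> r = s1" by (rule WhileTrue.IH)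
    with 2 t' show ?thesis using WhileTrue.IH(2) by blast
  next
    assume "\<not> operand_val xs s a < operand_val xs s b"
    with WhileTrue.hyps show ?thesis by blast
  qed
next
  case (WhileFalse s a b c)
  from WhileFalse.prems show ?case by (rule exec_WhileE) (use WhileFalse.hyps in blast)+
qed

definition input_size :: "nat list \<Rightarrow> nat" where
  "input_size xs = (\<Sum>x \<leftarrow> xs. bits x)"

definition halts_in_poly_time :: "com \<Rightarrow> nat list set \<Rightarrow> bool" where
  "halts_in_poly_time c X \<longleftrightarrow>
     (\<exists>p :: nat poly. \<forall>xs \<in> X. \<exists>t s. exec xs c (\<lambda>_. 0) t s \<and> t \<le> poly p (input_size xs))"


section \<open>Approximation algorithms\<close>

text \<open>
  \<open>encodes xs D lA w\<close>: the list \<open>xs\<close> describes the digraph on \<open>{0, ..., n - 1}\<close> with \<open>m\<close> arcs as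
  \<open>n\<close>, \<open>m\<close>, the vertices, and then for every arc, in arbitrary order, its tail, head, label, and
  the numerator and denominator of its weight. Only rational weights have an encoding, and
  fractions need not be reduced. Listing the vertices makes the size of the
  input at least \<open>n\<close>, so that there is time to write down a labeling even if most vertices are
  isolated.
\<close>

definition encodes ::
    "nat list \<Rightarrow> nat pair_pre_digraph \<Rightarrow> (nat \<times> nat \<Rightarrow> nat) \<Rightarrow> (nat \<times> nat \<Rightarrow> real) \<Rightarrow> bool" where
  "encodes xs D lA w \<longleftrightarrow>
     (\<exists>n es a b.
        pverts D = {..<n} \<and> distinct es \<and> set es = parcs D \<and>
        (\<forall>e \<in> parcs D. b e > (0::nat) \<and> w e = real (a e) / real (b e)) \<and>
        xs = [n, length es] @ [0..<n] @
             concat (map (\<lambda>(u, v). [u, v, lA (u, v), a (u, v), b (u, v)]) es))"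

text \<open>The labels are returned in consecutive registers, starting at the address in register 0.\<close>

definition output_labeling :: "store \<Rightarrow> nat \<Rightarrow> nat" where
  "output_labeling s v = s (s 0 + v)"

text \<open>Since execution is deterministic, quantifying over all halting runs loses nothing.\<close>

definition poly_time_approx_algorithm :: "nat \<Rightarrow> real \<Rightarrow> com \<Rightarrow> bool" where
  "poly_time_approx_algorithm T r c \<longleftrightarrow>
     halts_in_poly_time c {xs. \<exists>D lA w. gmd_instance T D lA w \<and> encodes xs D lA w} \<and>
     (\<forall>D lA w xs t s.
        gmd_instance T D lA w \<longrightarrow> encodes xs D lA w \<longrightarrow> exec xs c (\<lambda>_. 0) t s \<longrightarrow>
          output_labeling s \<in> labelings T D \<and>
          labeling_value D lA w (output_labeling s) \<ge> r * gmd_opt T D lA w)"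

end

theory Submission
  imports Defs
begin

text \<open>
  Let $M_v$ be the largest weight of non-loop arcs into $v$ with a common label and $M$ the sum of
  all $M_v$; then $\mathsf{Opt} \<le> M$. Once the set $Z$ of vertices labelled 0 is fixed, labeling every
  other vertex greedily is optimal. If every vertex joins $Z$ with probability $1/2$, pairwise
  independently, then the greedy completion has expected value at least $M/4$; the sets defined by
  the Walsh functions derandomize this with $O(n)$ candidates. This suffices unless
  $\mathsf{Opt} \<ge> (1 - 1/(32T)) M$. In that case, vertices labelled 0 by an optimal labeling
  have little incoming but almost all outgoing weight, so that the threshold set of the
  vertices $v$ with $4 T M_v$ at most the weight of the arcs out of $v$ is almost optimal: its greedy
  completion has value at least $M/2$. The algorithm
  takes the best of all these candidates, after scaling the weights to integers by the product of
  their denominators.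
\<close>

section \<open>Programs on bounded stores\<close>

text \<open>Let V be the optimum. A vertex labelled 0 forfeits M_v, so the zeros of an optimal
  labeling have M_v summing to at most M - V. The zeros themselves are unknown, hence a test that
  compares M_v with the outgoing weight. Its factor 4T comes from the fact that all arcs together
  weigh at most T M: members of the threshold set then have M_v summing to at most M/4, while the
  zeros it misses lose outgoing weight at most 4T(M - V). If M - V is at most M/(32T), the second
  loss is at most M/8, which leaves more than M/2. Otherwise V is below (1 - 1/(32T)) M, and M/4
  exceeds V/4 by at least V/(128T). Loops get weight 0: no labeling satisfies them, and their two
  ends cannot be independent. Under logarithmic cost, counting steps bounds the time only together
  with a bound on the length of all numbers, so both are proved together.\<close>

lemma bits_le: "k < 2 ^ L \<Longrightarrow> 0 < L \<Longrightarrow> bits k \<le> L"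
proof (cases "k = 0")
  case False
  assume k: "k < 2 ^ L"
  have "2 ^ floor_log k \<le> k" using False by (intro floor_log_exp2_le) simp
  then have "(2::nat) ^ floor_log k < 2 ^ L" using k by (rule le_less_trans)
  then show ?thesis by (simp add: bits_def)
qed (simp add: bits_def)

lemma less_two_power_bits: "k < 2 ^ bits k"
  using floor_log_exp2_gt[of k] by (simp add: bits_def)

fun small_operand :: "nat \<Rightarrow> operand \<Rightarrow> bool" where
  "small_operand q (Const k) = (k < q)"
| "small_operand q (Reg i) = (i < q)"
| "small_operand q (Ind i) = (i < q)"
| "small_operand q (Inp i) = (i < q)"

fun small_target :: "nat \<Rightarrow> target \<Rightarrow> bool" where
  "small_target q (ToReg i) = (i < q)"
| "small_target q (ToInd i) = (i < q)"

fun small_com :: "nat \<Rightarrow> com \<Rightarrow> bool" where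
  "small_com q (Assign d f a b) = (small_target q d \<and> small_operand q a \<and> small_operand q b)"
| "small_com q (Seq c1 c2) = (small_com q c1 \<and> small_com q c2)"
| "small_com q (IfLess a b c1 c2) = (small_operand q a \<and> small_operand q b \<and> small_com q c1 \<and> small_com q c2)"
| "small_com q (WhileLess a b c) = (small_operand q a \<and> small_operand q b \<and> small_com q c)"

text \<open>A uniform digit bound \<open>L\<close> turns logarithmic cost into step counting: every
  elementary action then costs O(\<open>L\<close>).\<close>

locale bounded_run =
  fixes xs :: "nat list" and L :: nat
  assumes L_pos: "0 < L"
    and input_lt: "input_word xs i < 2 ^ L"
begin

definition bounded :: "store \<Rightarrow> bool" where
  "bounded s \<longleftrightarrow> (\<forall>i. s i < 2 ^ L)"

text \<open>Total correctness with a budget of \<open>N\<close> steps. A step is worth 9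
  \<open>L\<close>: two operands of at most 3 \<open>L\<close>, a target of at most 2
  \<open>L\<close> and a result of at most \<open>L\<close>. The side conditions are premises inside
  the definition, so that the rules need not carry them and the constants of the program are checked
  only once.\<close>

definition wp :: "com \<Rightarrow> store \<Rightarrow> nat \<Rightarrow> (store \<Rightarrow> bool) \<Rightarrow> bool" where
  "wp c s N Q \<longleftrightarrow> (small_com (2 ^ L) c \<longrightarrow> bounded s \<longrightarrow>
     (\<exists>t s'. exec xs c s t s' \<and> t \<le> N * (9 * L) \<and> bounded s' \<and> Q s'))"

lemma operand_val_lt:
  assumes "bounded s" "small_operand (2 ^ L) a" shows "operand_val xs s a < 2 ^ L"
  using assms input_lt by (cases a) (auto simp: bounded_def)

lemma operand_cost_le:
  assumes "bounded s" "small_operand (2 ^ L) a" shows "operand_cost xs s a \<le> 3 * L"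
proof -
  have b: "k < 2 ^ L \<Longrightarrow> bits k \<le> L" for k using bits_le L_pos by blast
  have s: "bits (s i) \<le> L" for i using assms(1) b by (simp add: bounded_def)
  have i: "bits (input_word xs i) \<le> L" for i using input_lt b by blast
  show ?thesis
  proof (cases a)
    case (Const k) then show ?thesis using assms(2) b[of k] by simp
  next
    case (Reg k) then show ?thesis using assms(2) b[of k] s[of k] by simp
  next
    case (Ind k) then show ?thesis using assms(2) b[of k] s[of k] s[of "s k"] by simp
  next
    case (Inp k) then show ?thesis using assms(2) b[of k] s[of k] i[of "s k"] by simp
  qed
qed

lemma target_cost_le:
  assumes "bounded s" "small_target (2 ^ L) d" shows "target_cost s d \<le> 2 * L"
proof -
  have b: "k < 2 ^ L \<Longrightarrow> bits k \<le> L" for k using bits_le L_pos by blast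
  have s: "bits (s i) \<le> L" for i using assms(1) b by (simp add: bounded_def)
  show ?thesis
    using assms(2) by (cases d) (auto intro!: add_mono simp: mult_2 s b intro: le_trans[OF _ le_add1])
qed

text \<open>Truncated subtraction, division and copying cannot overflow.\<close>

fun fits :: "store \<Rightarrow> arith \<Rightarrow> operand \<Rightarrow> operand \<Rightarrow> bool" where
  "fits s Sub a b = True"
| "fits s Div a b = True"
| "fits s Add a b = (b = Const 0 \<or> operand_val xs s a + operand_val xs s b < 2 ^ L)"
| "fits s Mul a b = (operand_val xs s a * operand_val xs s b < 2 ^ L)"

lemma arith_val_lt:
  assumes "fits s f a b" "operand_val xs s a < 2 ^ L"
  shows "arith_val f (operand_val xs s a) (operand_val xs s b) < 2 ^ L"
proof (cases f)
  case Add with assms show ?thesis by auto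
next
  case Div with assms show ?thesis
    by simp (meson div_le_dividend le_less_trans)
qed (use assms in auto)

lemma wp_mono:
  "wp c s N Q \<Longrightarrow> N \<le> N' \<Longrightarrow> (\<And>s'. Q s' \<Longrightarrow> Q' s') \<Longrightarrow> wp c s N' Q'"
  unfolding wp_def by (meson le_trans mult_le_mono1)

lemma wp_Assign:
  assumes "fits s f a b" "1 \<le> N"
    and "Q (s(target_addr s d := arith_val f (operand_val xs s a) (operand_val xs s b)))"
  shows "wp (Assign d f a b) s N Q"
  unfolding wp_def
proof (intro impI exI conjI)
  assume sm: "small_com (2 ^ L) (Assign d f a b)" and bd: "bounded s"
  let ?r = "arith_val f (operand_val xs s a) (operand_val xs s b)"
  show "exec xs (Assign d f a b) s (operand_cost xs s a + operand_cost xs s b + target_cost s d + bits ?r)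
      (s(target_addr s d := ?r))" by (rule exec.Assign) simp
  have r: "?r < 2 ^ L" using arith_val_lt assms(1) operand_val_lt bd sm by simp
  then show "bounded (s(target_addr s d := ?r))" using bd by (simp add: bounded_def)
  have "operand_cost xs s a + operand_cost xs s b + target_cost s d + bits ?r \<le> 3*L + 3*L + 2*L + L"
    using bd sm by (intro add_mono operand_cost_le target_cost_le bits_le r L_pos) auto
  also have "\<dots> \<le> N * (9 * L)" using assms(2) by (cases N) auto
  finally show "operand_cost xs s a + operand_cost xs s b + target_cost s d + bits ?r \<le> N * (9 * L)" .
  show "Q (s(target_addr s d := ?r))" by (fact assms(3))
qed

lemma wp_Seq:
  assumes "wp c1 s N1 (\<lambda>s'. wp c2 s' N2 Q)" "N1 + N2 \<le> N"
  shows "wp (Seq c1 c2) s N Q"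
  unfolding wp_def
proof (intro impI)
  assume sm: "small_com (2 ^ L) (Seq c1 c2)" and bd: "bounded s"
  obtain t1 s1 where 1: "exec xs c1 s t1 s1" "t1 \<le> N1 * (9 * L)" "bounded s1" "wp c2 s1 N2 Q"
    using assms(1) sm bd unfolding wp_def[of c1] by auto
  obtain t2 s2 where 2: "exec xs c2 s1 t2 s2" "t2 \<le> N2 * (9 * L)" "bounded s2" "Q s2"
    using 1 sm unfolding wp_def[of c2] by auto
  have "t1 + t2 \<le> (N1 + N2) * (9 * L)" using 1(2) 2(2) by (simp add: algebra_simps)
  also have "\<dots> \<le> N * (9 * L)" using assms(2) by simp
  finally show "\<exists>t s'. exec xs (Seq c1 c2) s t s' \<and> t \<le> N * (9 * L) \<and> bounded s' \<and> Q s'"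
    using exec.Seq 1(1) 2 by blast
qed

lemma wp_Seq_spec:
  assumes "wp c1 s N1 P" "\<And>s'. P s' \<Longrightarrow> wp c2 s' N2 Q" "N1 + N2 \<le> N"
  shows "wp (Seq c1 c2) s N Q"
  by (rule wp_Seq[OF wp_mono[OF assms(1) order.refl] assms(3)]) (rule assms(2))

lemma wp_If:
  assumes "operand_val xs s a < operand_val xs s b \<Longrightarrow> wp c1 s N' Q"
    and "\<not> operand_val xs s a < operand_val xs s b \<Longrightarrow> wp c2 s N' Q"
    and "N' + 1 \<le> N"
  shows "wp (IfLess a b c1 c2) s N Q"
  unfolding wp_def
proof (intro impI)
  assume sm: "small_com (2 ^ L) (IfLess a b c1 c2)" and bd: "bounded s"
  let ?k = "operand_cost xs s a + operand_cost xs s b"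
  have k: "?k \<le> 6 * L" using operand_cost_le[of s a] operand_cost_le[of s b] bd sm by simp
  have le: "?k + t \<le> N * (9 * L)" if "t \<le> N' * (9 * L)" for t
  proof -
    have "?k + t \<le> (N' + 1) * (9 * L)" using k that by (simp add: algebra_simps)
    also have "\<dots> \<le> N * (9 * L)" using assms(3) mult_le_mono1 by blast
    finally show ?thesis .
  qed
  show "\<exists>t s'. exec xs (IfLess a b c1 c2) s t s' \<and> t \<le> N * (9 * L) \<and> bounded s' \<and> Q s'"
  proof (cases "operand_val xs s a < operand_val xs s b")
    case True
    then obtain t s' where "exec xs c1 s t s'" "t \<le> N' * (9 * L)" "bounded s'" "Q s'"
      using assms(1) sm bd unfolding wp_def by auto
    then show ?thesis using exec.IfTrue[OF True] le by blast
  next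
    case False
    then obtain t s' where "exec xs c2 s t s'" "t \<le> N' * (9 * L)" "bounded s'" "Q s'"
      using assms(2) sm bd unfolding wp_def by auto
    then show ?thesis using exec.IfFalse[OF False] le by blast
  qed
qed

text \<open>Strong induction on the measure \<open>f\<close>: each iteration pays \<open>d\<close>
  for the body and 1 for the test, and the failing test pays the final 1.\<close>

lemma wp_While:
  fixes f :: "store \<Rightarrow> nat"
  assumes I: "I s"
    and step: "\<And>s. I s \<Longrightarrow> operand_val xs s a < operand_val xs s b \<Longrightarrow> wp c s d (\<lambda>s'. I s' \<and> f s' < f s)"
    and exit: "\<And>s. I s \<Longrightarrow> \<not> operand_val xs s a < operand_val xs s b \<Longrightarrow> Q s"
    and N: "f s * (d + 1) + 1 \<le> N"
  shows "wp (WhileLess a b c) s N Q"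
proof -
  have "wp (WhileLess a b c) s (f s * (d + 1) + 1) Q"
    using I
  proof (induction "f s" arbitrary: s rule: less_induct)
    case less
    show ?case
      unfolding wp_def
    proof (intro impI)
      assume sm: "small_com (2 ^ L) (WhileLess a b c)" and bd: "bounded s"
      let ?k = "operand_cost xs s a + operand_cost xs s b"
      have k: "?k \<le> 9 * L" using operand_cost_le[of s a] operand_cost_le[of s b] bd sm by simp
      show "\<exists>t s'. exec xs (WhileLess a b c) s t s' \<and> t \<le> (f s * (d + 1) + 1) * (9 * L) \<and> bounded s' \<and> Q s'"
      proof (cases "operand_val xs s a < operand_val xs s b")
        case True
        from step[OF less.prems True] sm bd obtain t1 s1 where
          1: "exec xs c s t1 s1" "t1 \<le> d * (9 * L)" "bounded s1" "I s1" "f s1 < f s"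
          unfolding wp_def by auto
        from less.hyps[OF 1(5,4)] sm 1(3) obtain t2 s2 where
          2: "exec xs (WhileLess a b c) s1 t2 s2" "t2 \<le> (f s1 * (d + 1) + 1) * (9 * L)" "bounded s2" "Q s2"
          unfolding wp_def by blast
        have "?k + t1 + t2 \<le> (1 + d + (f s1 * (d + 1) + 1)) * (9 * L)"
          using k 1(2) 2(2) by (simp add: algebra_simps)
        also have "1 + d + (f s1 * (d + 1) + 1) = (f s1 + 1) * (d + 1) + 1" by simp
        also have "\<dots> * (9 * L) \<le> (f s * (d + 1) + 1) * (9 * L)"
          using 1(5) by (intro mult_le_mono1 add_mono) auto
        finally show ?thesis using exec.WhileTrue[OF True 1(1) 2(1)] 2 by blast
      next
        case False
        have "?k \<le> (f s * (d + 1) + 1) * (9 * L)" using k by (simp add: algebra_simps)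
        then show ?thesis using exec.WhileFalse[OF False] bd exit[OF less.prems False] by blast
      qed
    qed
  qed
  then show ?thesis using N by (rule wp_mono)
qed

text \<open>Loop-free code is run symbolically: \<open>result\<close> is the final store,
  \<open>all_fit\<close> collects the overflow conditions and \<open>steps\<close> is the budget.
  The clauses for \<open>WhileLess\<close> are placeholders that \<open>straight\<close> rules
  out.\<close>

fun straight :: "com \<Rightarrow> bool" where
  "straight (Assign d f a b) = True"
| "straight (Seq c1 c2) = (straight c1 \<and> straight c2)"
| "straight (IfLess a b c1 c2) = (straight c1 \<and> straight c2)"
| "straight (WhileLess a b c) = False"

fun result :: "com \<Rightarrow> store \<Rightarrow> store" where
  "result (Assign d f a b) s =
     s(target_addr s d := arith_val f (operand_val xs s a) (operand_val xs s b))"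
| "result (Seq c1 c2) s = result c2 (result c1 s)"
| "result (IfLess a b c1 c2) s =
     (if operand_val xs s a < operand_val xs s b then result c1 s else result c2 s)"
| "result (WhileLess a b c) s = s"

fun all_fit :: "com \<Rightarrow> store \<Rightarrow> bool" where
  "all_fit (Assign d f a b) s = fits s f a b"
| "all_fit (Seq c1 c2) s = (all_fit c1 s \<and> all_fit c2 (result c1 s))"
| "all_fit (IfLess a b c1 c2) s =
     (if operand_val xs s a < operand_val xs s b then all_fit c1 s else all_fit c2 s)"
| "all_fit (WhileLess a b c) s = False"

fun steps :: "com \<Rightarrow> nat" where
  "steps (Assign d f a b) = 1"
| "steps (Seq c1 c2) = steps c1 + steps c2"
| "steps (IfLess a b c1 c2) = max (steps c1) (steps c2) + 1"
| "steps (WhileLess a b c) = 0"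

lemma wp_straight_steps:
  "straight c \<Longrightarrow> all_fit c s \<Longrightarrow> Q (result c s) \<Longrightarrow> wp c s (steps c) Q"
proof (induction c arbitrary: s Q)
  case (Assign d f a b)
  then show ?case by (intro wp_Assign) auto
next
  case (Seq c1 c2)
  show ?case by (rule wp_Seq, rule Seq.IH(1)) (use Seq in auto)
next
  case (IfLess a b c1 c2)
  show ?case
  proof (rule wp_If[where N' = "max (steps c1) (steps c2)"])
    assume "operand_val xs s a < operand_val xs s b"
    with IfLess show "wp c1 s (max (steps c1) (steps c2)) Q"
      by (intro wp_mono[OF IfLess.IH(1)[of s Q]]) auto
  next
    assume "\<not> operand_val xs s a < operand_val xs s b"
    with IfLess show "wp c2 s (max (steps c1) (steps c2)) Q"
      by (intro wp_mono[OF IfLess.IH(2)[of s Q]]) auto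
  qed simp
qed simp

lemma wp_straight:
  assumes "straight c" "all_fit c s" "steps c \<le> N" "Q (result c s)"
  shows "wp c s N Q"
  using wp_mono[OF wp_straight_steps[where Q = Q, OF assms(1,2,4)] assms(3)] by blast

lemma wp_Seq_straight:
  assumes "straight c1" "all_fit c1 s" "steps c1 + N2 \<le> N" "wp c2 (result c1 s) N2 Q"
  shows "wp (Seq c1 c2) s N Q"
  by (rule wp_Seq[OF _ assms(3)]) (rule wp_straight[OF assms(1,2) order.refl], rule assms(4))

end


section \<open>Candidate sets\<close>

fun dot :: "nat \<Rightarrow> nat \<Rightarrow> nat" where
  "dot x y = (if x = 0 then 0 else (x mod 2) * (y mod 2) + dot (x div 2) (y div 2))"

declare dot.simps [simp del]

lemma dot_0 [simp]: "dot 0 y = 0"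
  by (simp add: dot.simps)

lemma dot_rec: "dot x y = (x mod 2) * (y mod 2) + dot (x div 2) (y div 2)"
  by (cases "x = 0") (simp_all add: dot.simps[of x])

text \<open>Serves the overflow check of the parity computation: the digit sum of \<open>x\<close>,
  hence \<open>dot x y\<close>, never exceeds \<open>x\<close>.\<close>

lemma dot_le: "dot x y \<le> x"
proof (induction x y rule: dot.induct)
  case (1 x y)
  show ?case
  proof (cases "x = 0")
    case False
    have "(x mod 2) * (y mod 2) \<le> x mod 2" by (cases "y mod 2 = 0") auto
    then have "dot x y \<le> x mod 2 + x div 2" using 1[OF False] dot_rec[of x y] by linarith
    also have "\<dots> \<le> x" by presburger
    finally show ?thesis .
  qed simp
qed

text \<open>These are the characters of the group of binary words: \<open>dot\<close> counts the
  positions where both numbers have the digit 1, and its parity is the inner product over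
  GF(2).\<close>

definition walsh :: "nat \<Rightarrow> nat \<Rightarrow> int" where
  "walsh x y = (- 1) ^ dot x y"

lemma sum_lessThan_double:
  fixes f :: "nat \<Rightarrow> 'a::comm_monoid_add"
  shows "(\<Sum>r<2 * N. f r) = (\<Sum>r<N. f (2 * r) + f (2 * r + 1))"
  by (induction N) (simp_all add: add.assoc)

text \<open>Splitting off the last digit of \<open>r\<close> leaves the sum for \<open>k\<close>
  times a factor that is 2 if the last digits of \<open>x\<close> and \<open>y\<close> agree and 0
  otherwise.\<close>

lemma walsh_orthogonal:
  "x < 2 ^ k \<Longrightarrow> y < 2 ^ k \<Longrightarrow>
    (\<Sum>r<2 ^ k. walsh x r * walsh y r) = (if x = y then 2 ^ k else 0)"
proof (induction k arbitrary: x y)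
  case 0
  then show ?case by (simp add: walsh_def)
next
  case (Suc k)
  have w0: "walsh x (2 * r) = walsh (x div 2) r" for x r
    using dot_rec[of x "2 * r"] by (simp add: walsh_def)
  have w1: "walsh x (2 * r + 1) = (- 1) ^ (x mod 2) * walsh (x div 2) r" for x r
    using dot_rec[of x "2 * r + 1"] by (simp add: walsh_def power_add)
  have "(\<Sum>r<2 ^ Suc k. walsh x r * walsh y r) =
      (\<Sum>r<2 ^ k. (1 + (- 1) ^ (x mod 2) * (- 1) ^ (y mod 2)) * (walsh (x div 2) r * walsh (y div 2) r))"
    unfolding power_Suc sum_lessThan_double w0 w1 by (simp add: algebra_simps)
  also have "\<dots> = (1 + (- 1) ^ (x mod 2) * (- 1) ^ (y mod 2)) * (if x div 2 = y div 2 then 2 ^ k else 0)"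
    using Suc.prems by (subst sum_distrib_left[symmetric], subst Suc.IH) auto
  also have "\<dots> = (if x = y then 2 ^ Suc k else 0)"
  proof (cases "x mod 2 = y mod 2")
    case True
    then have "x div 2 = y div 2 \<longleftrightarrow> x = y" by (metis div_mult_mod_eq)
    moreover have "(- 1 :: int) ^ (x mod 2) * (- 1) ^ (y mod 2) = 1"
      using True by (simp flip: power_mult_distrib)
    ultimately show ?thesis by simp
  next
    case False
    then have "x mod 2 = 0 \<and> y mod 2 = 1 \<or> x mod 2 = 1 \<and> y mod 2 = 0" by auto
    then show ?thesis using False by auto
  qed
  finally show ?case .
qed

text \<open>Four times the indicator of the event is (1 + \<open>walsh x r\<close>) (1 -
  \<open>walsh y r\<close>). Since 0, \<open>x\<close> and \<open>y\<close> are distinct,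
  orthogonality removes all terms of the expanded product except the constant 1.\<close>

lemma pairwise_independent_bits:
  assumes "0 < x" "0 < y" "x \<noteq> y" "x < 2 ^ k" "y < 2 ^ k"
  shows "4 * card {r. r < 2 ^ k \<and> even (dot x r) \<and> odd (dot y r)} = 2 ^ k"
proof -
  have "4 * int (card {r. r < 2 ^ k \<and> even (dot x r) \<and> odd (dot y r)}) =
      (\<Sum>r<2 ^ k. 4 * of_bool (even (dot x r) \<and> odd (dot y r)))"
    by (simp add: lessThan_def Int_def flip: sum_distrib_left)
  also have "\<dots> = (\<Sum>r<2 ^ k. (walsh 0 r * walsh 0 r) + walsh x r * walsh 0 r
      - walsh y r * walsh 0 r - walsh x r * walsh y r)"
    by (rule sum.cong) (auto simp: walsh_def minus_one_power_iff)
  also have "\<dots> = 2 ^ k"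
    unfolding sum.distrib sum_subtractf using assms by (simp add: walsh_orthogonal)
  finally show ?thesis
    by (metis (mono_tags, lifting) of_nat_eq_iff of_nat_mult of_nat_numeral of_nat_power)
qed

section \<open>Integer weights, greedy completions and the threshold set\<close>

locale labelled_arcs =
  fixes n m T :: nat and src dst lab wt :: "nat \<Rightarrow> nat"
  assumes src_less: "j < m \<Longrightarrow> src j < n"
    and dst_less: "j < m \<Longrightarrow> dst j < n"
    and lab_ge: "j < m \<Longrightarrow> 1 \<le> lab j"
    and lab_le: "j < m \<Longrightarrow> lab j \<le> T"
    and loop: "j < m \<Longrightarrow> src j = dst j \<Longrightarrow> wt j = 0"
    and T_pos: "1 \<le> T"
begin

definition score :: "(nat \<Rightarrow> bool) \<Rightarrow> nat \<Rightarrow> nat \<Rightarrow> nat" where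
  "score Z v i = (\<Sum>j<m. if dst j = v \<and> lab j = i \<and> Z (src j) then wt j else 0)"

definition best_score :: "(nat \<Rightarrow> bool) \<Rightarrow> nat \<Rightarrow> nat" where
  "best_score Z v = Max (score Z v ` {1..T})"

definition out_weight :: "nat \<Rightarrow> nat" where
  "out_weight v = (\<Sum>j<m. if src j = v then wt j else 0)"

definition greedy_value :: "(nat \<Rightarrow> bool) \<Rightarrow> nat" where
  "greedy_value Z = (\<Sum>v<n. if Z v then 0 else best_score Z v)"

definition value_of :: "(nat \<Rightarrow> nat) \<Rightarrow> nat" where
  "value_of lv = (\<Sum>j<m. if lv (src j) = 0 \<and> lv (dst j) = lab j then wt j else 0)"

text \<open>The index \<open>v + 1\<close> avoids 0, whose Walsh function is constant. Numbering the
  threshold set directly after the Walsh sets lets one loop search all candidates.\<close>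

definition candidate :: "nat \<Rightarrow> nat \<Rightarrow> nat \<Rightarrow> bool" where
  "candidate R r v \<longleftrightarrow>
     (if r < R then even (dot (v + 1) r) else 4 * T * best_score (\<lambda>_. True) v \<le> out_weight v)"

definition total :: nat where
  "total = (\<Sum>j<m. wt j)"

lemma score_le_best: "1 \<le> i \<Longrightarrow> i \<le> T \<Longrightarrow> score Z v i \<le> best_score Z v"
  by (simp add: best_score_def)

lemma best_score_attained: "\<exists>i. 1 \<le> i \<and> i \<le> T \<and> score Z v i = best_score Z v"
proof -
  have "best_score Z v \<in> score Z v ` {1..T}"
    unfolding best_score_def using T_pos by (intro Max_in) auto
  then show ?thesis by auto
qed

text \<open>All tails are below \<open>n\<close>, so a set read off the registers has to be right on
  the vertices only.\<close>

lemma score_cong: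
  assumes "\<And>u. u < n \<Longrightarrow> Z u = Z' u"
  shows "score Z v i = score Z' v i"
  unfolding score_def using assms src_less by (intro sum.cong refl) auto

lemma best_score_cong:
  assumes "\<And>u. u < n \<Longrightarrow> Z u = Z' u"
  shows "best_score Z v = best_score Z' v"
  unfolding best_score_def using score_cong[of Z Z', OF assms] by simp

lemma score_le_total: "score Z v i \<le> total"
  unfolding score_def total_def by (intro sum_mono) auto

lemma best_score_le_total: "best_score Z v \<le> total"
  using best_score_attained[of Z v] score_le_total[of Z v] by metis

text \<open>Each arc is counted once, at its head. This links sums over vertices, which describe the
  greedy choice, with sums over arcs, which describe values.\<close>

lemma sum_score_eq:
  "(\<Sum>v<n. if P v then score Z v (a v) else 0) =
   (\<Sum>j<m. if P (dst j) \<and> lab j = a (dst j) \<and> Z (src j) then wt j else 0)"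
proof -
  have "(\<Sum>v<n. if P v then score Z v (a v) else 0) =
      (\<Sum>v<n. \<Sum>j<m. if dst j = v then (if P v \<and> lab j = a v \<and> Z (src j) then wt j else 0) else 0)"
    unfolding score_def by (intro sum.cong refl) (auto intro!: sum.cong)
  also have "\<dots> = (\<Sum>j<m. \<Sum>v<n. if dst j = v then (if P v \<and> lab j = a v \<and> Z (src j) then wt j else 0) else 0)"
    by (rule sum.swap)
  also have "\<dots> = (\<Sum>j<m. if P (dst j) \<and> lab j = a (dst j) \<and> Z (src j) then wt j else 0)"
    by (intro sum.cong refl) (simp add: dst_less)
  finally show ?thesis .
qed

lemma sum_out_weight_eq:
  "(\<Sum>v<n. if P v then out_weight v else 0) = (\<Sum>j<m. if P (src j) then wt j else 0)"
proof -
  have "(\<Sum>v<n. if P v then out_weight v else 0) =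
      (\<Sum>v<n. \<Sum>j<m. if src j = v then (if P v then wt j else 0) else 0)"
    unfolding out_weight_def by (intro sum.cong refl) (auto intro!: sum.cong)
  also have "\<dots> = (\<Sum>j<m. \<Sum>v<n. if src j = v then (if P v then wt j else 0) else 0)"
    by (rule sum.swap)
  also have "\<dots> = (\<Sum>j<m. if P (src j) then wt j else 0)"
    by (intro sum.cong refl) (simp add: src_less)
  finally show ?thesis .
qed

lemma value_of_eq:
  "value_of lv = (\<Sum>v<n. if lv v \<noteq> 0 then score (\<lambda>u. lv u = 0) v (lv v) else 0)"
  unfolding sum_score_eq value_of_def
  \<comment> \<open>Arc labels are at least 1, so no satisfied arc ends in a vertex labelled
    0.\<close>
  by (intro sum.cong refl) (use lab_ge in force)

lemma greedy_value_of:
  assumes "\<And>v. v < n \<Longrightarrow> Z v \<longleftrightarrow> lv v = 0"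
    and "\<And>v. v < n \<Longrightarrow> \<not> Z v \<Longrightarrow> score Z v (lv v) = best_score Z v"
  shows "value_of lv = greedy_value Z"
proof -
  have "score (\<lambda>u. lv u = 0) v i = score Z v i" for v i
    unfolding score_def using assms(1) src_less by (intro sum.cong refl) auto
  then show ?thesis
    unfolding value_of_eq greedy_value_def using assms by (intro sum.cong) auto
qed

abbreviation majority :: "nat \<Rightarrow> nat" where
  "majority \<equiv> best_score (\<lambda>_. True)"

text \<open>Averaging over all \<open>r\<close>. Fix for every vertex a label \<open>a v\<close>
  attaining the majority. The greedy completion is at least as good as these labels, and a non-loop
  arc carrying the label fixed at its head survives in exactly a quarter of the sets.\<close>

lemma exists_quarter:
  assumes n: "n < 2 ^ k"
  shows "\<exists>r<2 ^ k. (\<Sum>v<n. majority v) \<le> 4 * greedy_value (candidate (2 ^ k) r)"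
proof -
  define R :: nat where "R = 2 ^ k"
  define Z where "Z r v \<longleftrightarrow> even (dot (v + 1) r)" for r v
  obtain a where a: "1 \<le> a v \<and> a v \<le> T \<and> score (\<lambda>_. True) v (a v) = majority v" for v
    using best_score_attained by metis
  have M: "(\<Sum>v<n. majority v) = (\<Sum>j<m. if lab j = a (dst j) then wt j else 0)"
    using sum_score_eq[of "\<lambda>_. True" "\<lambda>_. True" a] a by simp
  have ge: "(\<Sum>j<m. if \<not> Z r (dst j) \<and> lab j = a (dst j) \<and> Z r (src j) then wt j else 0) \<le> greedy_value (Z r)" for r
    unfolding sum_score_eq[of "\<lambda>v. \<not> Z r v", symmetric] greedy_value_def
    using a score_le_best by (intro sum_mono) auto
  have pair: "4 * (\<Sum>r<R. if \<not> Z r (dst j) \<and> lab j = a (dst j) \<and> Z r (src j) then wt j else 0) =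
      R * (if lab j = a (dst j) then wt j else 0)" if j: "j < m" for j
  \<comment> \<open>In the first case both sides vanish: loops weigh 0, and arcs with another label
    are not counted.\<close>
  proof (cases "src j = dst j \<or> lab j \<noteq> a (dst j)")
    case True
    then show ?thesis using loop[OF j] by auto
  next
    case False
    \<comment> \<open>The two indices are positive, distinct and below \<open>2 ^ k\<close>, since
      vertices are below \<open>n\<close> and \<open>n < 2 ^ k\<close>.\<close>
    have "4 * card {r. r < 2 ^ k \<and> even (dot (src j + 1) r) \<and> odd (dot (dst j + 1) r)} = 2 ^ k"
      using False src_less[OF j] dst_less[OF j] n by (intro pairwise_independent_bits) auto
    moreover have "(\<Sum>r<R. if \<not> Z r (dst j) \<and> lab j = a (dst j) \<and> Z r (src j) then wt j else 0) =
        (\<Sum>r\<in>{r. r < 2 ^ k \<and> even (dot (src j + 1) r) \<and> odd (dot (dst j + 1) r)}. wt j)"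
      using False unfolding R_def Z_def by (intro sum.mono_neutral_cong_right) auto
    ultimately show ?thesis using False by (simp add: R_def mult.assoc[symmetric])
  qed
  have "(\<Sum>r<R. \<Sum>v<n. majority v) = (\<Sum>j<m. R * (if lab j = a (dst j) then wt j else 0))"
    unfolding M by (simp add: sum_distrib_left)
  also have "\<dots> = (\<Sum>j<m. 4 * (\<Sum>r<R. if \<not> Z r (dst j) \<and> lab j = a (dst j) \<and> Z r (src j) then wt j else 0))"
    using pair by (intro sum.cong) auto
  also have "\<dots> = (\<Sum>r<R. 4 * (\<Sum>j<m. if \<not> Z r (dst j) \<and> lab j = a (dst j) \<and> Z r (src j) then wt j else 0))"
    unfolding sum_distrib_left[symmetric] by (subst sum.swap) (rule refl)
  also have "\<dots> \<le> (\<Sum>r<R. 4 * greedy_value (Z r))"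
    using ge by (intro sum_mono) simp
  finally have "(\<Sum>r<R. \<Sum>v<n. majority v) \<le> (\<Sum>r<R. 4 * greedy_value (Z r))" .
  moreover have "R > 0" by (simp add: R_def)
  \<comment> \<open>Otherwise every summand on the right would be strictly smaller, and hence the
    sum too.\<close>
  ultimately have "\<exists>r<R. (\<Sum>v<n. majority v) \<le> 4 * greedy_value (Z r)"
    by (metis (no_types, lifting) finite_lessThan lessThan_iff lessThan_empty_iff neq0_conv not_le sum_strict_mono)
  moreover have "Z r = candidate R r" if "r < R" for r
    using that by (auto simp: Z_def candidate_def fun_eq_iff)
  ultimately show ?thesis unfolding R_def by metis
qed

text \<open>The arcs into a vertex fall into \<open>T\<close> label classes, none heavier than the
  majority of the vertex.\<close>

lemma total_le: "total \<le> T * (\<Sum>v<n. majority v)"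
proof -
  have "total = (\<Sum>j<m. \<Sum>i\<in>{1..T}. if lab j = i then wt j else 0)"
    unfolding total_def using lab_ge lab_le by (intro sum.cong refl) simp
  also have "\<dots> = (\<Sum>i\<in>{1..T}. \<Sum>j<m. if lab j = i then wt j else 0)"
    by (rule sum.swap)
  also have "\<dots> = (\<Sum>i\<in>{1..T}. \<Sum>v<n. score (\<lambda>_. True) v i)"
    using sum_score_eq[of "\<lambda>_. True" "\<lambda>_. True" "\<lambda>_. i" for i] by simp
  also have "\<dots> \<le> (\<Sum>i\<in>{1..T}. \<Sum>v<n. majority v)"
    using score_le_best by (intro sum_mono) auto
  finally show ?thesis by simp
qed

text \<open>
  The error terms: satisfied arcs whose tail is a zero of the labeling outside the threshold set,
  and satisfied arcs whose head is in the threshold set.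
\<close>

lemma value_of_le_threshold:
  fixes lv :: "nat \<Rightarrow> nat"
  assumes lv: "\<And>v. v < n \<Longrightarrow> lv v \<le> T" and M: "M = (\<Sum>v<n. majority v)"
  shows "value_of lv \<le> M"
    and "4 * value_of lv \<le> 4 * greedy_value (candidate R R) + 16 * T * (M - value_of lv) + M"
proof -
  define G where "G = candidate R R"
  have G: "G v \<longleftrightarrow> 4 * T * majority v \<le> out_weight v" for v
    by (simp add: G_def candidate_def)
  define MZ where "MZ = (\<Sum>v<n. if lv v = 0 then majority v else 0)"
  have score_le: "score Z v i \<le> score (\<lambda>_. True) v i" for Z v i
    unfolding score_def by (intro sum_mono) auto
  \<comment> \<open>Only vertices with a nonzero label receive satisfied arcs, so the zeros lose
    their whole majority \<open>MZ\<close>.\<close>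
  have "value_of lv \<le> (\<Sum>v<n. if lv v \<noteq> 0 then majority v else 0)"
    unfolding value_of_eq using lv
    by (intro sum_mono) (auto intro: order_trans[OF score_le score_le_best])
  moreover have "M = (\<Sum>v<n. if lv v \<noteq> 0 then majority v else 0) + MZ"
    unfolding M MZ_def sum.distrib[symmetric] by (intro sum.cong) auto
  ultimately have V: "value_of lv + MZ \<le> M" by simp
  then show "value_of lv \<le> M" by simp
  define A where "A = (\<Sum>v<n. if lv v = 0 \<and> \<not> G v then out_weight v else 0)"
  define B where "B = (\<Sum>v<n. if G v then majority v else 0)"
  \<comment> \<open>A vertex outside the threshold set has outgoing weight below
    \<open>4 * T\<close> times its majority.\<close>
  have "A \<le> 4 * T * MZ"
    unfolding A_def MZ_def sum_distrib_left by (intro sum_mono) (auto simp: G)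
  moreover have "4 * T * MZ \<le> 4 * T * (M - value_of lv)"
    using V by (intro mult_le_mono2) simp
  ultimately have A: "A \<le> 4 * T * (M - value_of lv)" by (rule order_trans)
  \<comment> \<open>Members satisfy the reverse inequality, and the outgoing weights of all vertices
    sum to \<open>total\<close>.\<close>
  have "4 * T * B \<le> (\<Sum>v<n. if True then out_weight v else 0)"
    unfolding B_def sum_distrib_left by (intro sum_mono) (auto simp: G)
  also have "\<dots> = total" unfolding sum_out_weight_eq total_def by simp
  also have "\<dots> \<le> T * M" using total_le M by simp
  finally have "T * (4 * B) \<le> T * M" by (simp add: mult_ac)
  then have B: "4 * B \<le> M" using T_pos by simp
  \<comment> \<open>A satisfied arc with tail in \<open>G\<close> and head outside \<open>G\<close>
    falls under the first summand, any other one under an error term.\<close>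
  have "value_of lv \<le> (\<Sum>j<m. (if \<not> G (dst j) \<and> lab j = lv (dst j) \<and> G (src j) then wt j else 0)
      + (if lv (src j) = 0 \<and> \<not> G (src j) then wt j else 0)
      + (if (G (dst j) \<and> lv (dst j) \<noteq> 0) \<and> lab j = lv (dst j) \<and> True then wt j else 0))"
    unfolding value_of_def by (intro sum_mono) (use lab_ge in force)
  also have "\<dots> = (\<Sum>v<n. if \<not> G v then score G v (lv v) else 0) + A
      + (\<Sum>v<n. if G v \<and> lv v \<noteq> 0 then score (\<lambda>_. True) v (lv v) else 0)"
    unfolding A_def sum_score_eq sum_out_weight_eq sum.distrib by simp
  also have "\<dots> \<le> greedy_value G + A + B"
  proof (intro add_mono order.refl)
    \<comment> \<open>Label 0 occurs on no arc, so a zero of \<open>lv\<close> outside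
      \<open>G\<close> cannot beat its greedy label, although that label must be positive.\<close>
    have "score G v 0 = 0" for v
      unfolding score_def using lab_ge by (intro sum.neutral) force
    then have "score G v (lv v) \<le> best_score G v" if "v < n" for v
      using lv[OF that] score_le_best[of "lv v" G v] by (cases "lv v = 0") auto
    then show "(\<Sum>v<n. if \<not> G v then score G v (lv v) else 0) \<le> greedy_value G"
      unfolding greedy_value_def by (intro sum_mono) auto
    show "(\<Sum>v<n. if G v \<and> lv v \<noteq> 0 then score (\<lambda>_. True) v (lv v) else 0) \<le> B"
      unfolding B_def using lv score_le_best by (intro sum_mono) auto
  qed
  finally have "value_of lv \<le> greedy_value G + A + B" .
  with A B show "4 * value_of lv \<le> 4 * greedy_value (candidate R R) + 16 * T * (M - value_of lv) + M"
    unfolding G_def by simp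
qed

lemma exists_good_candidate:
  fixes lv :: "nat \<Rightarrow> nat"
  assumes lv: "\<And>v. v < n \<Longrightarrow> lv v \<le> T" and R: "R = 2 ^ k" "n < R"
  shows "\<exists>r\<le>R. (1/4 + (1/128) / real T) * real (value_of lv) \<le> real (greedy_value (candidate R r))"
proof -
  define M where "M = (\<Sum>v<n. majority v)"
  define V where "V = real (value_of lv)"
  have VM: "V \<le> real M" using value_of_le_threshold(1)[OF lv M_def] by (simp add: V_def)
  have V0: "0 \<le> V" by (simp add: V_def)
  have T1: "1 \<le> real T" using T_pos by simp
  show ?thesis
  proof (cases "32 * real T * (real M - V) \<le> real M")
    case True
    have "real (4 * value_of lv) \<le> real (4 * greedy_value (candidate R R) + 16 * T * (M - value_of lv) + M)"
      using value_of_le_threshold(2)[OF lv M_def] by (intro of_nat_mono) auto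
    then have 1: "4 * V \<le> 4 * real (greedy_value (candidate R R)) + 16 * (real T * (real M - V)) + real M"
      using value_of_le_threshold(1)[OF lv M_def] by (simp add: V_def of_nat_diff)
    \<comment> \<open>Dropping the factor \<open>T\<close> gives M - V \<le> M/32. The two losses
      then leave 4V - 3M/2, which is at least 2V.\<close>
    have "1 * (real M - V) \<le> real T * (real M - V)" using T1 VM by (intro mult_right_mono) auto
    with 1 True VM have 2: "V / 2 \<le> real (greedy_value (candidate R R))" by (simp add: mult.assoc)
    have "1/4 + (1/128) / real T \<le> 1/2" using T1 by (simp add: field_simps)
    then have "(1/4 + (1/128) / real T) * V \<le> 1/2 * V" using V0 by (rule mult_right_mono)
    with 2 show ?thesis unfolding V_def by (intro exI[of _ R]) auto
  next
    case False
    obtain r where r: "r < R" "M \<le> 4 * greedy_value (candidate R r)"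
      using exists_quarter R unfolding M_def by metis
    from r(2) have 1: "real M \<le> 4 * real (greedy_value (candidate R r))"
      by (metis of_nat_le_iff of_nat_mult of_nat_numeral)
    \<comment> \<open>This combines 32 T V < 32 T M - M with V \<le> M; division by 128 T then
      produces the ratio.\<close>
    have "V * (1 + 32 * real T) \<le> 32 * real T * real M"
      using False VM V0 by (simp add: algebra_simps)
    then have "(1/4 + (1/128) / real T) * V \<le> real M / 4"
      using T1 by (simp add: field_simps)
    with 1 r(1) show ?thesis unfolding V_def by (intro exI[of _ r]) auto
  qed
qed

end


section \<open>The program\<close>

abbreviation seq_infix :: "com \<Rightarrow> com \<Rightarrow> com" (infixr ";;" 60) where
  "c1 ;; c2 \<equiv> Seq c1 c2"

abbreviation copy :: "nat \<Rightarrow> operand \<Rightarrow> com" where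
  "copy d a \<equiv> Assign (ToReg d) Add a (Const 0)"

abbreviation store_at :: "nat \<Rightarrow> operand \<Rightarrow> com" where
  "store_at d a \<equiv> Assign (ToInd d) Add a (Const 0)"

abbreviation increase :: "nat \<Rightarrow> operand \<Rightarrow> com" where
  "increase d a \<equiv> Assign (ToReg d) Add (Reg d) a"

abbreviation add_to :: "nat \<Rightarrow> operand \<Rightarrow> operand \<Rightarrow> com" where
  "add_to d a b \<equiv> Assign (ToReg d) Add a b"

abbreviation skip :: com where
  "skip \<equiv> copy 24 (Const 0)"

abbreviation if_equal :: "operand \<Rightarrow> operand \<Rightarrow> com \<Rightarrow> com" where
  "if_equal a b c \<equiv> IfLess a b skip (IfLess b a skip c)"

text \<open>
  Register use: 1 and 2 hold the numbers of vertices and arcs, 3 the common denominator of the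
  weights, 4 the number $R$ of Walsh candidates, 5 the current candidate, 6 and 7 the best value and
  where it was attained, 8 is $R + 1$, 9 the value of the current candidate, 10 the current vertex,
  11 the bound below which a label counts as a tail, 12 and 13 the best score and its label,
  14 the current label, 15 an accumulator, 16 and 17 the arc counter and the input position,
  18 to 21 the current arc, 22 to 24 are scratch; the parity computation reuses 15 to 20. The label of vertex $v$ is in register $32 + v$;
  while a labeling is under construction, it is 0 iff $v$ belongs to the candidate.
\<close>

definition load_arc :: com where
  "load_arc =
     copy 18 (Inp 17) ;; increase 17 (Const 1) ;; copy 19 (Inp 17) ;; increase 17 (Const 1) ;;
     copy 20 (Inp 17) ;; increase 17 (Const 1) ;; copy 21 (Inp 17) ;; increase 17 (Const 1) ;;
     copy 22 (Inp 17) ;; increase 17 (Const 1) ;;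
     Assign (ToReg 22) Div (Reg 3) (Reg 22) ;; Assign (ToReg 21) Mul (Reg 21) (Reg 22) ;;
     if_equal (Reg 18) (Reg 19) (copy 21 (Const 0))"

text \<open>Every pass rereads the arcs from the input, starting behind the two counts and the
  \<open>n\<close> listed vertices; register 15 accumulates what \<open>c\<close> adds.\<close>

definition arc_loop :: "com \<Rightarrow> com" where
  "arc_loop c =
     (copy 15 (Const 0) ;; copy 16 (Const 0) ;; add_to 17 (Reg 1) (Const 2)) ;;
     WhileLess (Reg 16) (Reg 2) (load_arc ;; c ;; increase 16 (Const 1))"

definition score_com :: com where
  "score_com = arc_loop
     (if_equal (Reg 19) (Reg 10) (if_equal (Reg 20) (Reg 14)
       (add_to 23 (Reg 18) (Const 32) ;; IfLess (Ind 23) (Reg 11) (increase 15 (Reg 21)) skip)))"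

definition out_weight_com :: com where
  "out_weight_com = arc_loop (if_equal (Reg 18) (Reg 10) (increase 15 (Reg 21)))"

definition best_score_com :: "nat \<Rightarrow> com" where
  "best_score_com T =
     (copy 12 (Const 0) ;; copy 13 (Const 1) ;; copy 14 (Const 1)) ;;
     WhileLess (Reg 14) (Const (T + 1))
       (score_com ;;
        IfLess (Reg 12) (Reg 15) (copy 12 (Reg 15) ;; copy 13 (Reg 14)) skip ;;
        increase 14 (Const 1))"

definition parity_com :: com where
  "parity_com =
     (copy 15 (Const 0) ;; add_to 16 (Reg 10) (Const 1) ;; copy 17 (Reg 5)) ;;
     WhileLess (Const 0) (Reg 16)
       (Assign (ToReg 18) Div (Reg 16) (Const 2) ;; add_to 19 (Reg 18) (Reg 18) ;;
        Assign (ToReg 19) Sub (Reg 16) (Reg 19) ;; copy 16 (Reg 18) ;;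
        Assign (ToReg 18) Div (Reg 17) (Const 2) ;; add_to 20 (Reg 18) (Reg 18) ;;
        Assign (ToReg 20) Sub (Reg 17) (Reg 20) ;; copy 17 (Reg 18) ;;
        Assign (ToReg 19) Mul (Reg 19) (Reg 20) ;; increase 15 (Reg 19)) ;;
     Assign (ToReg 18) Div (Reg 15) (Const 2) ;; increase 18 (Reg 18) ;;
     Assign (ToReg 15) Sub (Reg 15) (Reg 18)"

definition threshold_com :: "nat \<Rightarrow> com" where
  "threshold_com T =
     copy 11 (Const (T + 1)) ;; best_score_com T ;;
     Assign (ToReg 12) Mul (Reg 12) (Const (4 * T)) ;; out_weight_com ;;
     IfLess (Reg 15) (Reg 12) (copy 15 (Const 1)) (copy 15 (Const 0))"

definition build_com :: "nat \<Rightarrow> com" where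
  "build_com T =
     copy 10 (Const 0) ;;
     WhileLess (Reg 10) (Reg 1)
       (IfLess (Reg 5) (Reg 4) parity_com (threshold_com T) ;;
        add_to 23 (Reg 10) (Const 32) ;; store_at 23 (Reg 15) ;; increase 10 (Const 1))"

definition fill_com :: "nat \<Rightarrow> com" where
  "fill_com T =
     (copy 11 (Const 1) ;; copy 9 (Const 0) ;; copy 10 (Const 0)) ;;
     WhileLess (Reg 10) (Reg 1)
       (add_to 23 (Reg 10) (Const 32) ;;
        IfLess (Const 0) (Ind 23)
          (best_score_com T ;; add_to 23 (Reg 10) (Const 32) ;; store_at 23 (Reg 13) ;;
           increase 9 (Reg 12))
          skip ;;
        increase 10 (Const 1))"

text \<open>Scores depend on the membership of all vertices, so the whole set is built before any
  label is chosen.\<close>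

definition try_com :: "nat \<Rightarrow> com" where
  "try_com T = build_com T ;; fill_com T"

definition read_com :: com where
  "read_com =
     (copy 1 (Inp 0) ;; copy 16 (Const 1) ;; copy 2 (Inp 16) ;; copy 3 (Const 1) ;;
      copy 16 (Const 0) ;; add_to 17 (Reg 1) (Const 6)) ;;
     WhileLess (Reg 16) (Reg 2)
       (copy 22 (Inp 17) ;; Assign (ToReg 3) Mul (Reg 3) (Reg 22) ;;
        increase 17 (Const 5) ;; increase 16 (Const 1))"

definition power_com :: com where
  "power_com =
     (copy 4 (Const 1) ;; add_to 16 (Reg 1) (Const 1)) ;;
     WhileLess (Reg 4) (Reg 16) (increase 4 (Reg 4))"

definition search_com :: "nat \<Rightarrow> com" where
  "search_com T =
     (add_to 8 (Reg 4) (Const 1) ;; copy 5 (Const 0) ;; copy 6 (Const 0) ;; copy 7 (Const 0)) ;;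
     WhileLess (Reg 5) (Reg 8)
       (try_com T ;;
        IfLess (Reg 6) (Reg 9) (copy 6 (Reg 9) ;; copy 7 (Reg 5)) skip ;;
        increase 5 (Const 1))"

text \<open>The best labeling is not stored but recomputed from the number of its candidate; finally
  register 0 receives the address of the labels.\<close>

definition gmd_com :: "nat \<Rightarrow> com" where
  "gmd_com T = read_com ;; power_com ;; search_com T ;; copy 5 (Reg 7) ;; try_com T ;; copy 0 (Const 32)"

lemmas com_defs = gmd_com_def search_com_def power_com_def read_com_def try_com_def fill_com_def
  build_com_def threshold_com_def parity_com_def best_score_com_def out_weight_com_def
  score_com_def arc_loop_def load_arc_def

lemma small_gmd_com: "4 * T + 64 \<le> q \<Longrightarrow> small_com q (gmd_com T)"
  by (simp add: com_defs)

section \<open>Correctness and cost of the subroutines\<close>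

definition same :: "nat \<Rightarrow> store \<Rightarrow> store \<Rightarrow> bool" where
  "same k s s' \<longleftrightarrow> (\<forall>x. x < k \<or> 32 \<le> x \<longrightarrow> s' x = s x)"

lemma same_trans: "same k s s' \<Longrightarrow> same l s' s'' \<Longrightarrow> k \<le> l \<Longrightarrow> same k s s''"
  by (auto simp: same_def)

text \<open>Ties the arcs to the input words and collects all size bounds in one place. The factor
  \<open>n + 4 * T + 1\<close> covers both a sum of at most \<open>n\<close> best scores and
  \<open>4 * T\<close> times a majority.\<close>

locale gmd_run =
  labelled_arcs n m T src dst lab wt + bounded_run xs L
  for n m T :: nat and src dst lab wt :: "nat \<Rightarrow> nat" and xs :: "nat list" and L :: nat +
  fixes num den :: "nat \<Rightarrow> nat" and D :: nat
  assumes word_0: "input_word xs 0 = n"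
    and word_1: "input_word xs 1 = m"
    and word_arc: "j < m \<Longrightarrow> input_word xs (n + 2 + 5 * j) = src j \<and>
      input_word xs (n + 3 + 5 * j) = dst j \<and> input_word xs (n + 4 + 5 * j) = lab j \<and>
      input_word xs (n + 5 + 5 * j) = num j \<and> input_word xs (n + 6 + 5 * j) = den j"
    and wt_eq: "wt j = (if src j = dst j then 0 else num j * (D div den j))"
    and den_pos: "j < m \<Longrightarrow> 0 < den j"
    and D_eq: "D = (\<Prod>j<m. den j)"
    and size_lt: "2 * n + 5 * m + 4 * T + 64 < 2 ^ L"
    and D_lt: "D < 2 ^ L"
    and num_lt: "j < m \<Longrightarrow> num j * (D div den j) < 2 ^ L"
    and total_lt: "(n + 4 * T + 1) * total < 2 ^ L"
begin

definition ready :: "store \<Rightarrow> bool" where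
  "ready s \<longleftrightarrow> s 1 = n \<and> s 2 = m \<and> s 3 = D"

lemma ready_same: "same k s s' \<Longrightarrow> 3 < k \<Longrightarrow> ready s' = ready s"
  by (auto simp: ready_def same_def)

lemma total_less: "total < 2 ^ L"
  using total_lt by simp

text \<open>Partial sums never exceed \<open>total\<close>, so the accumulator fits. Registers 23
  and 24 are left open because bodies compute addresses in 23 and \<open>skip\<close> clears
  24.\<close>

lemma wp_arc_loop:
  assumes s: "ready s" and st: "straight c"
    and fit: "\<And>s' j. j < m \<Longrightarrow> same 15 s s' \<Longrightarrow> s' 18 = src j \<Longrightarrow> s' 19 = dst j \<Longrightarrow> s' 20 = lab j \<Longrightarrow>
       s' 21 = wt j \<Longrightarrow> s' 15 + wt j < 2 ^ L \<Longrightarrow> all_fit c s'"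
    and c: "\<And>s' j. j < m \<Longrightarrow> same 15 s s' \<Longrightarrow> s' 18 = src j \<Longrightarrow> s' 19 = dst j \<Longrightarrow> s' 20 = lab j \<Longrightarrow>
       s' 21 = wt j \<Longrightarrow> \<exists>x y. result c s' = s'(23 := x, 24 := y, 15 := s' 15 + (if P j then wt j else 0))"
    and N: "m * (steps c + 17) + 4 \<le> N"
  shows "wp (arc_loop c) s N (\<lambda>s'. same 15 s s' \<and> s' 15 = (\<Sum>j<m. if P j then wt j else 0))"
  unfolding arc_loop_def
proof (rule wp_Seq_straight[where ?N2.0 = "m * (steps c + 17) + 1"], goal_cases)
  case 4
  define I where "I s' \<longleftrightarrow> same 15 s s' \<and> s' 16 \<le> m \<and> s' 17 = n + 2 + 5 * s' 16 \<and>
    s' 15 = (\<Sum>j<s' 16. if P j then wt j else 0)" for s'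
  show ?case
  proof (rule wp_While[where I = I and d = "steps c + 16" and f = "\<lambda>s. m - s 16"], goal_cases)
    case 1
    then show ?case using s by (auto simp: I_def same_def ready_def)
  next
    case (2 s')
    define j where "j = s' 16"
    have sm: "same 15 s s'" and s15: "s' 15 = (\<Sum>j<j. if P j then wt j else 0)"
      and s17: "s' 17 = n + 2 + 5 * j"
      using 2 by (auto simp: I_def j_def)
    have j: "j < m" using 2 sm s by (simp add: j_def ready_def same_def)
    note w = word_arc[OF j]
    have s3: "s' 3 = D" using sm s by (simp add: ready_def same_def)
    have lt: "n + 7 + 5 * j < 2 ^ L" using j size_lt by linarith
    have "(\<Sum>j<j. if P j then wt j else 0) + wt j \<le> (\<Sum>j<j. wt j) + wt j"
      by (intro add_mono sum_mono) auto
    also have "\<dots> = sum wt {..<Suc j}" by simp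
    also have "\<dots> \<le> total" unfolding total_def using j by (intro sum_mono2) auto
    finally have acc: "s' 15 + wt j < 2 ^ L" using total_less s15 by simp
    define s2 where "s2 = result load_arc s'"
    have s2: "s2 18 = src j" "s2 19 = dst j" "s2 20 = lab j" "s2 21 = wt j" "s2 17 = n + 7 + 5 * j"
      "s2 16 = j" "s2 15 = s' 15" "same 15 s' s2"
      unfolding s2_def load_arc_def using w s17 s3
      by (auto simp: wt_eq eval_nat_numeral same_def j_def)
    have sm2: "same 15 s s2" using same_trans[OF sm s2(8)] by simp
    obtain x y where c2: "result c s2 = s2(23 := x, 24 := y, 15 := s2 15 + (if P j then wt j else 0))"
      using c[OF j sm2 s2(1-4)] by blast
    have fit1: "all_fit load_arc s'"
      unfolding load_arc_def using w s17 s3 lt num_lt[OF j]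
      by (auto simp: eval_nat_numeral)
    have fit2: "all_fit c s2" using fit[OF j sm2 s2(1-4)] acc s2(7) by simp
    show ?case
    proof (rule wp_straight, goal_cases)
      case 1 then show ?case using st by (simp add: load_arc_def)
    next
      case 2 then show ?case using fit1 fit2 c2 s2 j size_lt by (simp add: s2_def[symmetric])
    next
      case 3 then show ?case by (simp add: load_arc_def)
    next
      case 4 then show ?case using c2 s2 j s15 sm2
        by (auto simp add: s2_def[symmetric] I_def same_def j_def[symmetric])
    qed
  next
    case (3 s')
    then have "s' 16 = m" using s by (auto simp: I_def same_def ready_def)
    with 3 show ?case by (simp add: I_def)
  next
    case 4 then show ?case by simp
  qed
qed (use s size_lt N in \<open>auto simp: ready_def\<close>)

text \<open>With 1 in register 11 this is the set of zeros, with \<open>T + 1\<close> it is every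
  vertex, so that the same code computes greedy scores and majorities.\<close>

abbreviation current :: "store \<Rightarrow> nat \<Rightarrow> bool" where
  "current s \<equiv> (\<lambda>u. s (32 + u) < s 11)"

lemma wp_score:
  assumes s: "ready s" and N: "m * 30 + 4 \<le> N"
  shows "wp score_com s N (\<lambda>s'. same 15 s s' \<and> s' 15 = score (current s) (s 10) (s 14))"
  unfolding score_com_def score_def
proof (rule wp_arc_loop[OF s], goal_cases)
  case (2 s' j)
  then show ?case using src_less[of j] size_lt by auto
next
  case (3 s' j)
  have "s' 10 = s 10" "s' 14 = s 14" "s' 11 = s 11" "s' (32 + src j) = s (32 + src j)"
    using 3(2) by (auto simp: same_def)
  then show ?case using 3
    by (auto simp: fun_upd_def fun_eq_iff add.commute intro: exI[of _ "s' 23"] exI[of _ "s' 24"])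
qed (use N in auto)

lemma wp_out_weight:
  assumes s: "ready s" and N: "m * 30 + 4 \<le> N"
  shows "wp out_weight_com s N (\<lambda>s'. same 15 s s' \<and> s' 15 = out_weight (s 10))"
  unfolding out_weight_com_def out_weight_def
proof (rule wp_arc_loop[OF s], goal_cases)
  case (3 s' j)
  have "s' 10 = s 10" using 3(2) by (auto simp: same_def)
  then show ?case using 3
    by (auto simp: fun_upd_def fun_eq_iff intro: exI[of _ "s' 23"] exI[of _ "s' 24"])
qed (use N in auto)

lemma current_same: "same k s s' \<Longrightarrow> 11 < k \<Longrightarrow> current s' = current s"
  by (auto simp: same_def)

lemma wp_best_score:
  assumes s: "ready s" and N: "T * (30 * m + 9) + 4 \<le> N"
  shows "wp (best_score_com T) s N (\<lambda>s'. same 12 s s' \<and> s' 12 = best_score (current s) (s 10) \<and>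
    1 \<le> s' 13 \<and> s' 13 \<le> T \<and> score (current s) (s 10) (s' 13) = best_score (current s) (s 10))"
  unfolding best_score_com_def
proof (rule wp_Seq_straight[where ?N2.0 = "T * (30 * m + 9) + 1"], goal_cases)
  case 4
  define sc where "sc = score (current s) (s 10)"
  define I where "I s' \<longleftrightarrow> same 12 s s' \<and> 1 \<le> s' 14 \<and> s' 14 \<le> T + 1 \<and>
    (\<forall>i. 1 \<le> i \<and> i < s' 14 \<longrightarrow> sc i \<le> s' 12) \<and>
    (s' 14 = 1 \<and> s' 12 = 0 \<and> s' 13 = 1 \<or> 1 \<le> s' 13 \<and> s' 13 < s' 14 \<and> s' 12 = sc (s' 13))" for s'
  show ?case
  proof (rule wp_While[where I = I and d = "30 * m + 8" and f = "\<lambda>s. T + 1 - s 14"], goal_cases)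
    case 1
    then show ?case using T_pos by (auto simp: I_def same_def)
  next
    case (2 s1)
    have sm: "same 12 s s1" using 2 by (simp add: I_def)
    show ?case
    proof (rule wp_Seq_spec[OF wp_score[OF _ order.refl], where ?N2.0 = 4], goal_cases)
      case 1 then show ?case using ready_same[OF sm] s by simp
    next
      case (2 s2)
      have s2: "same 12 s s2" "s2 12 = s1 12" "s2 13 = s1 13" "s2 14 = s1 14" "s2 15 = sc (s1 14)"
        using 2 same_trans[OF sm conjunct1[OF 2]] current_same[of 12 s s1] sm
        by (auto simp: sc_def same_def)
      show ?case
      proof (rule wp_straight, goal_cases)
        case 4
        have old: "sc i \<le> s1 12" if "1 \<le> i" "i < s1 14" for i
          using \<open>I s1\<close> that unfolding I_def by blast
        have new: "\<forall>i. 1 \<le> i \<and> i < s1 14 + 1 \<longrightarrow> sc i \<le> max (s1 12) (sc (s1 14))"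
        proof (intro allI impI)
          fix i assume i: "1 \<le> i \<and> i < s1 14 + 1"
          then show "sc i \<le> max (s1 12) (sc (s1 14))"
            using old[of i] by (cases "i = s1 14") auto
        qed
        have lt: "s1 14 < T + 1" using \<open>operand_val xs s1 (Reg 14) < _\<close> by simp
        have rng: "1 \<le> s1 14" and alt: "s1 14 = 1 \<and> s1 12 = 0 \<and> s1 13 = 1 \<or>
            1 \<le> s1 13 \<and> s1 13 < s1 14 \<and> s1 12 = sc (s1 13)"
          using \<open>I s1\<close> by (simp_all add: I_def)
        show ?case
        proof (cases "s1 12 < sc (s1 14)")
          case True
          then have "\<forall>i. 1 \<le> i \<and> i < s1 14 + 1 \<longrightarrow> sc i \<le> sc (s1 14)"
            using new by (simp add: max_def)
          then show ?thesis using True s2 rng lt by (simp add: I_def same_def)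
        next
          case False
          then have "\<forall>i. 1 \<le> i \<and> i < s1 14 + 1 \<longrightarrow> sc i \<le> s1 12"
            using new by (simp add: max_def)
          \<comment> \<open>If label 1 has score 0, the strict test fails, and the initial score 0
            with label 1 is already correct.\<close>
          moreover have "1 \<le> s1 13 \<and> s1 13 < s1 14 + 1 \<and> s1 12 = sc (s1 13)"
            using alt False by auto
          ultimately show ?thesis using False s2 lt by (simp add: I_def same_def)
        qed
      qed (use s2 \<open>operand_val xs s1 (Reg 14) < _\<close> size_lt in auto)
    qed simp
  next
    case (3 s')
    then have I: "I s'" and e: "s' 14 = T + 1" by (auto simp: I_def)
    have le: "sc i \<le> s' 12" if "1 \<le> i" "i \<le> T" for i using I that e by (auto simp: I_def)
    have a: "1 \<le> s' 13" "s' 13 \<le> T" "s' 12 = sc (s' 13)" using I e T_pos by (auto simp: I_def)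
    obtain i where "1 \<le> i" "i \<le> T" "sc i = best_score (current s) (s 10)"
      using best_score_attained unfolding sc_def by blast
    then have "s' 12 = best_score (current s) (s 10)"
      using le[of i] a score_le_best[of "s' 13" "current s" "s 10"] by (auto simp: sc_def)
    then show ?case using a I by (auto simp: I_def sc_def)
  next
    case 4 then show ?case by simp
  qed
qed (use N in auto)

text \<open>The accumulated count plus the \<open>dot\<close> of the remaining digits stays
  constant. Bounding the number of halvings by \<open>n\<close> is crude but enough, since the input
  lists all vertices.\<close>

lemma wp_parity:
  assumes s: "s 10 < n" "s 5 \<le> 2 * n + 2" and N: "11 * n + 7 \<le> N"
  shows "wp parity_com s N (\<lambda>s'. same 15 s s' \<and> s' 15 = dot (s 10 + 1) (s 5) mod 2)"
  unfolding parity_com_def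
proof (rule wp_Seq_straight[where ?N2.0 = "11 * n + 4"], goal_cases)
  case 4
  define I where "I s' \<longleftrightarrow> same 15 s s' \<and> s' 15 + dot (s' 16) (s' 17) = dot (s 10 + 1) (s 5) \<and>
    s' 16 \<le> n \<and> s' 17 \<le> s 5" for s'
  have lt: "dot (s 10 + 1) (s 5) < 2 ^ L" using dot_le[of "s 10 + 1" "s 5"] s size_lt by linarith
  show ?case
  proof (rule wp_Seq_spec[where P = "\<lambda>s'. I s' \<and> s' 16 = 0" and ?N2.0 = 3],
      rule wp_While[where I = I and d = 10 and f = "\<lambda>s. s 16" and N = "n * 11 + 1"], goal_cases)
    case 1
    then show ?case using s by (auto simp: I_def same_def)
  next
    case (2 s1)
    have m1: "a - (a div 2 + a div 2) = a mod 2" for a :: nat by presburger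
    show ?case
    proof (rule wp_straight, goal_cases)
      case 2
      have "s1 15 + (s1 16 mod 2) * (s1 17 mod 2) \<le> dot (s 10 + 1) (s 5)"
        using \<open>I s1\<close> dot_rec[of "s1 16" "s1 17"] by (simp add: I_def)
      moreover have "(s1 16 mod 2) * (s1 17 mod 2) \<le> 1 * 1" by (intro mult_le_mono) auto
      ultimately have "s1 15 + (s1 16 mod 2) * (s1 17 mod 2) < 2 ^ L"
        "(s1 16 mod 2) * (s1 17 mod 2) < 2 ^ L" using lt size_lt by linarith+
      moreover have "s1 16 div 2 + s1 16 div 2 < 2 ^ L" "s1 17 div 2 + s1 17 div 2 < 2 ^ L"
      proof -
        have "s1 16 \<le> n" "s1 17 \<le> s 5" using \<open>I s1\<close> unfolding I_def by blast+
        then show "s1 16 div 2 + s1 16 div 2 < 2 ^ L" "s1 17 div 2 + s1 17 div 2 < 2 ^ L"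
          using size_lt s by linarith+
      qed
      ultimately show ?case by (simp add: m1)
    next
      case 4
      then show ?case using \<open>I s1\<close> dot_rec[of "s1 16" "s1 17"] \<open>operand_val xs s1 _ < _\<close>
        by (auto simp: I_def same_def m1)
    qed simp_all
  next
    case (3 s')
    then show ?case by (simp add: I_def)
  next
    case 4
    then show ?case using s by simp
  next
    case (5 s')
    then have s15: "s' 15 = dot (s 10 + 1) (s 5)" by (auto simp: I_def)
    have "a div 2 + a div 2 < 2 ^ L" if "a < 2 ^ L" for a :: nat using that by linarith
    moreover have "a - (a div 2 + a div 2) = a mod 2" for a :: nat by presburger
    ultimately show ?case
      using 5 s15 lt by (intro wp_straight) (auto simp: I_def same_def)
  qed simp
qed (use N s size_lt in auto)

lemma wp_threshold:
  assumes s: "ready s" and X: "\<And>u. u < n \<Longrightarrow> s (32 + u) \<le> T"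
    and N: "T * (30 * m + 9) + 30 * m + 12 \<le> N"
  shows "wp (threshold_com T) s N (\<lambda>s'. same 11 s s' \<and>
    s' 15 = (if 4 * T * majority (s 10) \<le> out_weight (s 10) then 0 else 1))"
  unfolding threshold_com_def
proof (rule wp_Seq_straight[where ?N2.0 = "T * (30 * m + 9) + 30 * m + 11"], goal_cases)
  case 4
  let ?s = "result (copy 11 (Const (T + 1))) s"
  \<comment> \<open>No label exceeds \<open>T\<close>, so every vertex counts as a tail.\<close>
  have cur: "best_score (current ?s) (s 10) = majority (s 10)"
    by (rule best_score_cong) (use X in \<open>auto simp: less_Suc_eq_le\<close>)
  have "same 11 s ?s" by (simp add: same_def)
  have rdy: "ready ?s" using s by (simp add: ready_def)
  show ?case
  proof (rule wp_Seq_spec[OF wp_best_score[OF rdy order.refl], where ?N2.0 = "30 * m + 7"], goal_cases)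
    case (1 s1)
    then have s1: "same 11 s s1" "s1 12 = majority (s 10)"
      using cur by (auto simp: same_def)
    have "4 * T * majority (s 10) \<le> (n + 4 * T + 1) * total"
      by (intro mult_le_mono best_score_le_total) simp
    then have lt: "majority (s 10) * (4 * T) < 2 ^ L" using total_lt by (simp add: mult_ac)
    let ?t = "result (Assign (ToReg 12) Mul (Reg 12) (Const (4 * T))) s1"
    have rdyt: "ready ?t" using ready_same[OF s1(1)] s by (simp add: ready_def)
    show ?case
    proof (rule wp_Seq_straight[where ?N2.0 = "30 * m + 6"], goal_cases)
      case 4
      show ?case
      proof (rule wp_Seq_spec[OF wp_out_weight[OF rdyt order.refl], where ?N2.0 = 2], goal_cases)
        case (1 s2)
        have "s1 10 = s 10" using s1 by (simp add: same_def)
        then show ?case using 1 s1 by (intro wp_straight) (auto simp: same_def mult_ac)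
      qed simp
    qed (use s1 lt in auto)
  qed simp
qed (use N in auto)

text \<open>Labels of an earlier candidate may still occupy the registers of unprocessed vertices.
  The threshold test needs only that they are at most \<open>T\<close>, and the marks 0 and 1
  respect this bound.\<close>

lemma wp_build:
  assumes s: "ready s" "s 5 \<le> s 4" "s 4 \<le> 2 * n + 1" and X: "\<And>u. u < n \<Longrightarrow> s (32 + u) \<le> T"
    and N: "n * (T * (30 * m + 9) + 30 * m + 11 * n + 24) + 2 \<le> N"
  shows "wp (build_com T) s N (\<lambda>s'. (\<forall>x<10. s' x = s x) \<and>
    (\<forall>u<n. s' (32 + u) = (if candidate (s 4) (s 5) u then 0 else 1)))"
  unfolding build_com_def
proof (rule wp_Seq_straight[where ?N2.0 = "n * (T * (30 * m + 9) + 30 * m + 11 * n + 24) + 1"], goal_cases)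
  case 4
  define I where "I s' \<longleftrightarrow> (\<forall>x<10. s' x = s x) \<and> s' 10 \<le> n \<and> (\<forall>u<n. s' (32 + u) \<le> T) \<and>
    (\<forall>u<s' 10. s' (32 + u) = (if candidate (s 4) (s 5) u then 0 else 1))" for s'
  show ?case
  proof (rule wp_While[where I = I and d = "T * (30 * m + 9) + 30 * m + 11 * n + 23" and f = "\<lambda>s. n - s 10"],
      goal_cases)
    case 1
    then show ?case using X by (auto simp: I_def)
  next
    case (2 s1)
    have s1: "\<And>x. x < 10 \<Longrightarrow> s1 x = s x" "\<And>u. u < n \<Longrightarrow> s1 (32 + u) \<le> T"
      "\<And>u. u < s1 10 \<Longrightarrow> s1 (32 + u) = (if candidate (s 4) (s 5) u then 0 else 1)"
      using 2 by (auto simp: I_def)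
    have v: "s1 10 < n" using 2(2) s1(1)[of 1] s by (simp add: ready_def)
    have rdy: "ready s1" using s(1) s1(1) by (simp add: ready_def)
    have "wp (IfLess (Reg 5) (Reg 4) parity_com (threshold_com T)) s1
        (T * (30 * m + 9) + 30 * m + 11 * n + 20)
        (\<lambda>s'. same 11 s1 s' \<and> s' 15 = (if candidate (s 4) (s 5) (s1 10) then 0 else 1))"
    proof (rule wp_If[where N' = "T * (30 * m + 9) + 30 * m + 11 * n + 19"], goal_cases)
      case 1
      then have lt: "s 5 < s 4" using s1(1) by simp
      have "s1 5 \<le> 2 * n + 2" using s s1(1) by simp
      from wp_parity[OF v this order.refl] show ?case
        by (rule wp_mono) (use lt s1(1) in \<open>auto simp: same_def candidate_def even_iff_mod_2_eq_zero\<close>)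
    next
      case 2
      then have "\<not> s 5 < s 4" using s1(1) by simp
      then show ?case
        by (intro wp_mono[OF wp_threshold[OF rdy s1(2) order.refl]]) (auto simp: candidate_def)
    qed simp
    then show ?case
    proof (rule wp_Seq_spec[where ?N2.0 = 3], goal_cases)
      case (1 s2)
      then have s2: "s2 10 = s1 10" "\<And>u. s2 (32 + u) = s1 (32 + u)" "\<And>x. x < 10 \<Longrightarrow> s2 x = s x"
        "s2 15 = (if candidate (s 4) (s 5) (s1 10) then 0 else 1)"
        using s1(1) by (auto simp: same_def)
      show ?case
      proof (rule wp_straight, goal_cases)
        case 4
        show ?case
          using s1 s2 v T_pos by (auto simp: I_def add.commute less_Suc_eq)
      qed (use v s2 size_lt in auto)
    qed simp
  next
    case (3 s')
    then show ?case using s by (auto simp: I_def ready_def)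
  next
    case 4 then show ?case by simp
  qed
qed (use N in auto)

definition good_labels :: "(nat \<Rightarrow> bool) \<Rightarrow> (nat \<Rightarrow> nat) \<Rightarrow> nat \<Rightarrow> bool" where
  "good_labels Z lv u \<longleftrightarrow> (if Z u then lv u = 0
     else 1 \<le> lv u \<and> lv u \<le> T \<and> score Z u (lv u) = best_score Z u)"

text \<open>Labels overwrite the membership marks in place. Greedy labels are at least 1, so the
  zero registers remain exactly the members of \<open>Z\<close> and later scores are
  unaffected.\<close>

lemma wp_fill:
  assumes s: "ready s" and X: "\<And>u. u < n \<Longrightarrow> s (32 + u) = (if Z u then 0 else 1)"
    and N: "n * (T * (30 * m + 9) + 11) + 4 \<le> N"
  shows "wp (fill_com T) s N (\<lambda>s'. (\<forall>x<9. s' x = s x) \<and> s' 9 = greedy_value Z \<and>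
    (\<forall>u<n. good_labels Z (\<lambda>u. s' (32 + u)) u))"
  unfolding fill_com_def
proof (rule wp_Seq_straight[where ?N2.0 = "n * (T * (30 * m + 9) + 11) + 1"], goal_cases)
  case 4
  define I where "I s' \<longleftrightarrow> (\<forall>x<9. s' x = s x) \<and> s' 11 = 1 \<and> s' 10 \<le> n \<and>
    (\<forall>u<n. s' (32 + u) = 0 \<longleftrightarrow> Z u) \<and> s' 9 = (\<Sum>v<s' 10. if Z v then 0 else best_score Z v) \<and>
    (\<forall>u<s' 10. good_labels Z (\<lambda>u. s' (32 + u)) u)" for s'
  show ?case
  proof (rule wp_While[where I = I and d = "T * (30 * m + 9) + 10" and f = "\<lambda>s. n - s 10"], goal_cases)
    case 1
    then show ?case using X by (auto simp: I_def)
  next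
    case (2 s1)
    define v where "v = s1 10"
    define s2 where "s2 = result (add_to 23 (Reg 10) (Const 32)) s1"
    have s1: "\<And>x. x < 9 \<Longrightarrow> s1 x = s x" "s1 11 = 1" "\<And>u. u < n \<Longrightarrow> s1 (32 + u) = 0 \<longleftrightarrow> Z u"
      "s1 9 = (\<Sum>v<v. if Z v then 0 else best_score Z v)"
      "\<And>u. u < v \<Longrightarrow> good_labels Z (\<lambda>u. s1 (32 + u)) u"
      using 2 by (auto simp: I_def v_def)
    have v: "v < n" using 2(2) s1(1)[of 1] s by (simp add: ready_def v_def)
    have s2: "\<And>x. x \<noteq> 23 \<Longrightarrow> s2 x = s1 x" "s2 23 = 32 + v"
      by (simp_all add: s2_def v_def)
    have "(\<Sum>v<v. if Z v then 0 else best_score Z v) + best_score Z v \<le> (\<Sum>v<Suc v. total)"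
      unfolding sum.lessThan_Suc by (intro add_mono sum_mono) (auto simp: best_score_le_total)
    also have "\<dots> \<le> (n + 4 * T + 1) * total" using v by simp
    finally have lt: "(\<Sum>v<v. if Z v then 0 else best_score Z v) + best_score Z v < 2 ^ L"
      using total_lt by simp
    have "wp (IfLess (Const 0) (Ind 23)
          (best_score_com T ;; add_to 23 (Reg 10) (Const 32) ;; store_at 23 (Reg 13) ;;
           increase 9 (Reg 12)) skip) s2 (T * (30 * m + 9) + 8)
        (\<lambda>s'. (\<forall>x<9. s' x = s x) \<and> s' 11 = 1 \<and> s' 10 = v \<and>
          (\<forall>u<n. s' (32 + u) = 0 \<longleftrightarrow> Z u) \<and> s' 9 = (\<Sum>v<Suc v. if Z v then 0 else best_score Z v) \<and>
          (\<forall>u<Suc v. good_labels Z (\<lambda>u. s' (32 + u)) u))"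
    proof (rule wp_If[where N' = "T * (30 * m + 9) + 7"], goal_cases)
      case 1
      then have nZ: "\<not> Z v" using s2 s1(3)[OF v] by simp
      have rdy: "ready s2" using s s1(1) s2(1) by (simp add: ready_def)
      have cur: "best_score (current s2) v = best_score Z v" "score (current s2) v i = score Z v i" for i
        by (rule best_score_cong score_cong; use s1(2,3) s2(1) in simp)+
      show ?case
      proof (rule wp_Seq_spec[OF wp_best_score[OF rdy order.refl], where ?N2.0 = 3], goal_cases)
        case (1 s3)
        have v2: "s2 10 = v" using s2(1) by (simp add: v_def)
        from 1 have s3: "same 12 s2 s3" "s3 12 = best_score Z v" "1 \<le> s3 13" "s3 13 \<le> T"
          "score Z v (s3 13) = best_score Z v"
          unfolding v2 cur by auto
        have s3x: "s3 x = s1 x" if "x < 12 \<or> 32 \<le> x" for x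
          using s3(1) s2(1)[of x] that by (auto simp: same_def)
        have s3v: "s3 10 = v" using s3x by (simp add: v_def)
        let ?t = "result (add_to 23 (Reg 10) (Const 32) ;; store_at 23 (Reg 13) ;; increase 9 (Reg 12)) s3"
        have t: "?t (32 + u) = (if u = v then s3 13 else s1 (32 + u))" for u
          using s3x s3v by (auto simp: add.commute[of _ 32])
        have t': "\<forall>x<9. ?t x = s x" "?t 11 = 1" "?t 10 = v"
          "?t 9 = (\<Sum>v<Suc v. if Z v then 0 else best_score Z v)"
          using s3x s3v s3(2) s1(1,2,4) nZ by auto
        have zero: "?t (32 + u) = 0 \<longleftrightarrow> Z u" if "u < n" for u
          unfolding t using s1(3)[OF that] nZ s3(3) by auto
        have good: "good_labels Z (\<lambda>u. ?t (32 + u)) u" if "u < Suc v" for u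
          unfolding t using s1(5)[of u] that nZ s3(3-5) by (cases "u = v") (auto simp: good_labels_def)
        show ?case
        proof (rule wp_straight, goal_cases)
          case 2
          show ?case using s3x[of 9] s3v s3(2) s1(4) lt v size_lt by auto
        next
          case 4
          show ?case using t' zero good by blast
        qed auto
      qed simp
    next
      case 2
      then have Zv: "Z v" using s2 s1(3)[OF v] by simp
      have good: "good_labels Z (\<lambda>u. s1 (32 + u)) u" if "u < Suc v" for u
        using s1(5)[of u] s1(3)[OF v] Zv that by (cases "u = v") (auto simp: good_labels_def)
      show ?case
      proof (rule wp_straight, goal_cases)
        case 4
        show ?case using s1(1-4) s2(1) good Zv by (simp add: v_def)
      qed auto
    qed simp
    then have "wp (IfLess (Const 0) (Ind 23)
          (best_score_com T ;; add_to 23 (Reg 10) (Const 32) ;; store_at 23 (Reg 13) ;;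
           increase 9 (Reg 12)) skip ;; increase 10 (Const 1)) s2 (T * (30 * m + 9) + 9)
        (\<lambda>s'. I s' \<and> n - s' 10 < n - s1 10)"
    proof (rule wp_Seq_spec[where ?N2.0 = 1], goal_cases)
      case (1 s3)
      show ?case
      proof (rule wp_straight, goal_cases)
        case 4
        show ?case using 1 v by (auto simp: I_def v_def[symmetric])
      qed (use 1 v size_lt in auto)
    qed simp
    then show ?case
      unfolding s2_def by (rule wp_Seq_straight[rotated 3]) (use v size_lt in \<open>auto simp: v_def\<close>)
  next
    case (3 s')
    then have "s' 10 = n" using s by (auto simp: I_def ready_def)
    then show ?case using 3 by (auto simp: I_def greedy_value_def)
  next
    case 4 then show ?case by simp
  qed
qed (use N in auto)


abbreviation candidate_value :: "nat \<Rightarrow> nat \<Rightarrow> nat" where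
  "candidate_value R r \<equiv> greedy_value (candidate R r)"

definition try_steps :: nat where
  "try_steps = n * (2 * (T * (30 * m + 9)) + 30 * m + 11 * n + 35) + 6"

lemma wp_try:
  assumes s: "ready s" "s 5 \<le> s 4" "s 4 \<le> 2 * n + 1" and X: "\<And>u. u < n \<Longrightarrow> s (32 + u) \<le> T"
  shows "wp (try_com T) s try_steps (\<lambda>s'. (\<forall>x<9. s' x = s x) \<and>
    s' 9 = candidate_value (s 4) (s 5) \<and>
    (\<forall>u<n. good_labels (candidate (s 4) (s 5)) (\<lambda>u. s' (32 + u)) u))"
  unfolding try_com_def
proof (rule wp_Seq_spec[OF wp_build[OF s X order.refl]], assumption)
  fix s1 assume s1: "(\<forall>x<10. s1 x = s x) \<and>
    (\<forall>u<n. s1 (32 + u) = (if candidate (s 4) (s 5) u then 0 else 1))"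
  then have "ready s1" using s(1) by (simp add: ready_def)
  from wp_fill[OF this, of "candidate (s 4) (s 5)", OF _ order.refl] s1
  show "wp (fill_com T) s1 (n * (T * (30 * m + 9) + 11) + 4) (\<lambda>s'. (\<forall>x<9. s' x = s x) \<and>
    s' 9 = candidate_value (s 4) (s 5) \<and>
    (\<forall>u<n. good_labels (candidate (s 4) (s 5)) (\<lambda>u. s' (32 + u)) u))"
    by (auto elim: wp_mono)
qed (simp add: try_steps_def algebra_simps)

lemma good_labels_le: "good_labels Z lv u \<Longrightarrow> lv u \<le> T"
  by (auto simp: good_labels_def split: if_splits)

lemma good_labels_value:
  assumes "\<And>u. u < n \<Longrightarrow> good_labels Z lv u"
  shows "value_of lv = greedy_value Z"
proof (rule greedy_value_of)
  fix v assume "v < n"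
  from assms[OF this] show "Z v \<longleftrightarrow> lv v = 0" "\<not> Z v \<Longrightarrow> score Z v (lv v) = best_score Z v"
    by (auto simp: good_labels_def split: if_splits)
qed

section \<open>Reading the input and searching through the candidates\<close>

lemma wp_read:
  assumes N: "m * 5 + 7 \<le> N"
  shows "wp read_com (\<lambda>_. 0) N (\<lambda>s'. ready s' \<and> s' 0 = 0 \<and> (\<forall>u. s' (32 + u) = 0))"
  unfolding read_com_def
proof (rule wp_Seq_straight[where ?N2.0 = "m * 5 + 1"], goal_cases)
  case 4
  \<comment> \<open>Position \<open>n + 6\<close> holds the first denominator: two counts,
    \<open>n\<close> vertices and four words of the first arc precede it.\<close>
  define I where "I s' \<longleftrightarrow> s' 0 = 0 \<and> (\<forall>u. s' (32 + u) = 0) \<and> s' 1 = n \<and> s' 2 = m \<and> s' 16 \<le> m \<and>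
    s' 17 = n + 6 + 5 * s' 16 \<and> s' 3 = (\<Prod>j<s' 16. den j)" for s' :: store
  show ?case
  proof (rule wp_While[where I = I and d = 4 and f = "\<lambda>s. m - s 16"], goal_cases)
    case 1
    then show ?case by (auto simp: I_def word_0 word_1[simplified])
  next
    case (2 s1)
    then have j: "s1 16 < m" by (simp add: I_def)
    have w: "input_word xs (s1 17) = den (s1 16)"
      using 2 word_arc[OF j] by (simp add: I_def)
    \<comment> \<open>Partial products divide the positive number \<open>D\<close>, hence fit as
      well.\<close>
    have "(\<Prod>j<s1 16. den j) * den (s1 16) = (\<Prod>j<Suc (s1 16). den j)" by simp
    also have "\<dots> dvd D" unfolding D_eq using j by (intro prod_dvd_prod_subset) auto
    finally have "(\<Prod>j<s1 16. den j) * den (s1 16) \<le> D"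
      using den_pos unfolding D_eq by (intro dvd_imp_le prod_pos) auto
    then have "(\<Prod>j<s1 16. den j) * den (s1 16) < 2 ^ L" using D_lt by simp
    then show ?case
      using 2 j w size_lt by (intro wp_straight) (auto simp: I_def)
  next
    case (3 s')
    then have "s' 16 = m" by (simp add: I_def)
    then show ?case using 3 by (simp add: I_def ready_def flip: D_eq)
  next
    case 4 then show ?case by simp
  qed
qed (use N size_lt in \<open>auto simp: word_0 word_1[simplified]\<close>)

text \<open>The last value to be doubled is at most \<open>n\<close>, which keeps the number of
  candidates linear; the extra 1 in \<open>2 * n + 1\<close> serves \<open>n = 0\<close>.\<close>

lemma wp_power:
  assumes s: "ready s" "\<forall>u. s (32 + u) = 0" and N: "n * 2 + 5 \<le> N"
  shows "wp power_com s N (\<lambda>s'. ready s' \<and> (\<forall>u. s' (32 + u) = 0) \<and>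
    n < s' 4 \<and> s' 4 \<le> 2 * n + 1 \<and> (\<exists>k. s' 4 = 2 ^ k))"
  unfolding power_com_def
proof (rule wp_Seq_straight[where ?N2.0 = "n * 2 + 3"], goal_cases)
  case 4
  define I where "I s' \<longleftrightarrow> ready s' \<and> (\<forall>u. s' (32 + u) = 0) \<and> s' 16 = n + 1 \<and>
    1 \<le> s' 4 \<and> s' 4 \<le> 2 * n + 1 \<and> (\<exists>k. s' 4 = 2 ^ k)" for s' :: store
  show ?case
  proof (rule wp_While[where I = I and d = 1 and f = "\<lambda>s. n + 1 - s 4"], goal_cases)
    case 1
    have "\<exists>k. (1::nat) = 2 ^ k" by (rule exI[of _ 0]) simp
    then show ?case using s by (auto simp: I_def ready_def)
  next
    case (2 s1)
    have s1: "ready s1" "\<forall>u. s1 (32 + u) = 0" "s1 16 = n + 1" "1 \<le> s1 4" "s1 4 < n + 1"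
      using 2 by (simp_all add: I_def)
    obtain k where "s1 4 = 2 ^ k" using 2 by (auto simp: I_def)
    then have "s1 4 + s1 4 = 2 ^ Suc k" by simp
    then have ex: "\<exists>k. s1 4 + s1 4 = 2 ^ k" by blast
    show ?case
    proof (rule wp_straight, goal_cases)
      case 4
      have "n + 1 - (s1 4 + s1 4) < n + 1 - s1 4" "s1 4 + s1 4 \<le> 2 * n + 1" using s1(4,5) by linarith+
      with s1 ex show ?case by (simp add: I_def ready_def)
    qed (use s1 size_lt in auto)
  next
    case (3 s')
    then show ?case by (auto simp: I_def)
  next
    case 4 then show ?case by simp
  qed
qed (use N s size_lt in \<open>auto simp: ready_def\<close>)

lemma wp_search:
  assumes s: "ready s" "\<forall>u. s (32 + u) = 0" "s 4 \<le> 2 * n + 1"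
    and N: "(2 * n + 2) * (try_steps + 5) + 5 \<le> N"
  shows "wp (search_com T) s N (\<lambda>s'. ready s' \<and> s' 4 = s 4 \<and> (\<forall>u<n. s' (32 + u) \<le> T) \<and>
    s' 7 \<le> s 4 \<and> (\<forall>r\<le>s 4. candidate_value (s 4) r \<le> candidate_value (s 4) (s' 7)))"
  unfolding search_com_def
proof (rule wp_Seq_straight[where ?N2.0 = "(2 * n + 2) * (try_steps + 5) + 1"], goal_cases)
  case 4
  define R where "R = s 4"
  \<comment> \<open>For the recorded best value an inequality is enough, and it holds for the
    initial values 0 of registers 6 and 7.\<close>
  define I where "I s' \<longleftrightarrow> ready s' \<and> s' 4 = R \<and> s' 8 = R + 1 \<and> s' 5 \<le> R + 1 \<and> s' 7 \<le> R \<and>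
    (\<forall>u<n. s' (32 + u) \<le> T) \<and> (\<forall>r<s' 5. candidate_value R r \<le> s' 6) \<and> s' 6 \<le> candidate_value R (s' 7)"
    for s' :: store
  show ?case
  proof (rule wp_While[where I = I and d = "try_steps + 4" and f = "\<lambda>s. R + 1 - s 5"], goal_cases)
    case 1
    then show ?case using s by (auto simp: I_def ready_def R_def)
  next
    case (2 s1)
    have s1: "ready s1" "s1 5 \<le> s1 4" "s1 4 \<le> 2 * n + 1" "\<And>u. u < n \<Longrightarrow> s1 (32 + u) \<le> T"
      using 2 s(3) by (auto simp: I_def R_def)
    show ?case
    proof (rule wp_Seq_spec[OF wp_try[OF s1], where ?N2.0 = 4], assumption, goal_cases)
      case (1 s2)
      have s2: "\<And>x. x < 9 \<Longrightarrow> s2 x = s1 x" "s2 9 = candidate_value R (s1 5)"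
        using 1 2 by (auto simp: I_def)
      have X: "s2 (32 + u) \<le> T" if "u < n" for u
        using 1 that good_labels_le[of _ "\<lambda>u. s2 (32 + u)" u] by blast
      have old: "candidate_value R r \<le> s1 6" if "r < s1 5" for r using 2 that by (simp add: I_def)
      have new: "\<forall>r<s1 5 + 1. candidate_value R r \<le> max (s1 6) (candidate_value R (s1 5))"
      proof (intro allI impI)
        fix r assume r: "r < s1 5 + 1"
        then show "candidate_value R r \<le> max (s1 6) (candidate_value R (s1 5))"
          using old[of r] by (cases "r = s1 5") auto
      qed
      have I: "s1 4 = R" "s1 8 = R + 1" "s1 7 \<le> R" "s1 6 \<le> candidate_value R (s1 7)" "s1 5 < R + 1"
        using 2 by (simp_all add: I_def)
      show ?case
      proof (rule wp_straight, goal_cases)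
        case 4
        show ?case
        proof (cases "s1 6 < candidate_value R (s1 5)")
          case True
          then have "\<forall>r<s1 5 + 1. candidate_value R r \<le> candidate_value R (s1 5)"
            using new by (simp add: max_def)
          then show ?thesis using True s1 s2 X I by (simp add: I_def ready_def)
        next
          case False
          then have "\<forall>r<s1 5 + 1. candidate_value R r \<le> s1 6"
            using new by (simp add: max_def)
          then show ?thesis using False s1 s2 X I by (simp add: I_def ready_def)
        qed
      next
        case 2
        show ?case using s2(1) I(5) s(3) size_lt by (simp add: R_def)
      qed auto
    qed simp
  next
    case (3 s')
    then have e: "s' 5 = R + 1" by (auto simp: I_def)
    have "candidate_value R r \<le> candidate_value R (s' 7)" if "r \<le> R" for r
      using 3(1) e that unfolding I_def by (metis le_imp_less_Suc Suc_eq_plus1 order_trans)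
    then show ?case using 3(1) unfolding I_def R_def by blast
  next
    case 4
    have "(R + 1) * (try_steps + 4 + 1) \<le> (2 * n + 2) * (try_steps + 5)"
      using s(3) by (intro mult_le_mono) (auto simp: R_def)
    then show ?case by simp
  qed
qed (use N s size_lt in auto)

text \<open>The factor \<open>2 * n + 3\<close> pays for at most \<open>2 * n + 2\<close> candidates
  and the final recomputation.\<close>

definition total_steps :: nat where
  "total_steps = 5 * m + 2 * n + (2 * n + 3) * (try_steps + 5) + 20"

lemma wp_gmd:
  "wp (gmd_com T) (\<lambda>_. 0) total_steps (\<lambda>s'. s' 0 = 32 \<and> (\<forall>u<n. s' (32 + u) \<le> T) \<and>
    (\<exists>k. n < 2 ^ k \<and> (\<forall>r\<le>2 ^ k. candidate_value (2 ^ k) r \<le> value_of (\<lambda>u. s' (32 + u)))))"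
  unfolding gmd_com_def
proof (rule wp_Seq_spec[OF wp_read[OF order.refl],
      where ?N2.0 = "2 * n + (2 * n + 3) * (try_steps + 5) + 13"], goal_cases)
  case (1 s1)
  show ?case
  proof (rule wp_Seq_spec[OF wp_power[OF _ _ order.refl],
        where ?N2.0 = "(2 * n + 3) * (try_steps + 5) + 8"], goal_cases)
    case (3 s2)
    then obtain k where k: "s2 4 = 2 ^ k" by blast
    show ?case
    proof (rule wp_Seq_spec[OF wp_search[OF _ _ _ order.refl], where ?N2.0 = "try_steps + 2"], goal_cases)
      case (4 s3)
      show ?case
      proof (rule wp_Seq_straight[where ?N2.0 = "try_steps + 1"], goal_cases)
        case 4
        let ?s = "result (copy 5 (Reg 7)) s3"
        have s: "ready ?s" "?s 5 \<le> ?s 4" "?s 4 \<le> 2 * n + 1" "\<And>u. u < n \<Longrightarrow> ?s (32 + u) \<le> T"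
          using \<open>ready s3 \<and> _\<close> 3 by (auto simp: ready_def)
        have s45: "?s 4 = 2 ^ k" "?s 5 = s3 7" using \<open>ready s3 \<and> _\<close> k by auto
        show ?case
        proof (rule wp_Seq_spec[OF wp_try[OF s], where ?N2.0 = 1], assumption, goal_cases)
          case (1 s4)
          have "value_of (\<lambda>u. s4 (32 + u)) = candidate_value (2 ^ k) (s3 7)"
            using 1 unfolding s45 by (intro good_labels_value) auto
          then have "\<forall>r\<le>2 ^ k. candidate_value (2 ^ k) r \<le> value_of (\<lambda>u. s4 (32 + u))"
            using \<open>ready s3 \<and> _\<close> k by simp
          moreover have "\<forall>u<n. s4 (32 + u) \<le> T"
            using 1 good_labels_le[of _ "\<lambda>u. s4 (32 + u)"] by blast
          moreover have "n < 2 ^ k" using 3 k by simp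
          ultimately show ?case
            by (intro wp_straight) auto
        qed simp
      qed auto
    qed (use 3 in \<open>auto simp: algebra_simps\<close>)
  qed (use 1 in auto)
qed (simp add: total_steps_def)

end


section \<open>Input encoding and approximation ratio\<close>

lemma length_concat_uniform:
  assumes "\<And>e. length (f e) = c"
  shows "length (concat (map f es)) = c * length es"
  by (induction es) (simp_all add: assms)

lemma nth_concat_uniform:
  assumes "\<And>e. length (f e) = c" "j < length es" "i < c"
  shows "concat (map f es) ! (c * j + i) = f (es ! j) ! i"
  using assms(2)
proof (induction es arbitrary: j)
  case (Cons e es)
  then show ?case using assms(1,3) by (cases j) (simp_all add: nth_append)
qed simp

text \<open>Binary lengths add up under multiplication. This is why the product of all denominators
  is no longer than the input.\<close>

lemma prod_list_le_power_bits: "prod_list ys \<le> 2 ^ (\<Sum>y\<leftarrow>ys. bits y)"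
  by (induction ys) (auto simp: power_add intro!: mult_le_mono less_imp_le[OF less_two_power_bits])

text \<open>The time bound is \<open>total_steps\<close> times the price 9 \<open>L\<close> of a
  step, with the input size in place of \<open>n\<close> and \<open>m\<close>.\<close>

lemma gmd_com_correct:
  assumes inst: "gmd_instance T D lA w" and enc: "encodes xs D lA w" and T: "1 \<le> T"
  obtains t s where "exec xs (gmd_com T) (\<lambda>_. 0) t s"
    "t \<le> (let S = input_size xs in
       (7 * S + (2 * S + 3) * (S * (2 * (T * (30 * S + 9)) + 41 * S + 35) + 11) + 20) *
       (9 * (8 * S + 4 * T + 64)))"
    "output_labeling s \<in> labelings T D"
    "(1/4 + (1/128) / real T) * gmd_opt T D lA w \<le> labeling_value D lA w (output_labeling s)"
proof -
  obtain n es a b where verts: "pverts D = {..<n}" and es: "distinct es" "set es = parcs D"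
    and ab: "\<And>e. e \<in> parcs D \<Longrightarrow> b e > (0::nat) \<and> w e = real (a e) / real (b e)"
    and xs: "xs = [n, length es] @ [0..<n] @
      concat (map (\<lambda>(u, v). [u, v, lA (u, v), a (u, v), b (u, v)]) es)"
    using enc unfolding encodes_def by blast
  define f where "f = (\<lambda>e. [fst e, snd e, lA e, a e, b e])"
  have f: "(\<lambda>(u, v). [u, v, lA (u, v), a (u, v), b (u, v)]) = f"
    by (auto simp: f_def fun_eq_iff)
  have len_f: "length (f e) = 5" for e by (simp add: f_def)
  define m where "m = length es"
  define S where "S = input_size xs"
  \<comment> \<open>The largest exponent met below is 4 \<open>S\<close> + 4 \<open>T\<close> + 1,
    for the scaled total weight; 64 leaves room for the constants in the program.\<close>
  define L where "L = 8 * S + 4 * T + 64"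
  define src dst lab num den where "src j = fst (es ! j)" and "dst j = snd (es ! j)"
    and "lab j = lA (es ! j)" and "num j = a (es ! j)" and "den j = b (es ! j)" for j
  define B where "B = (\<Prod>j<m. den j)"
  define wt where "wt j = (if src j = dst j then 0 else num j * (B div den j))" for j
  have xs': "xs = [n, m] @ [0..<n] @ concat (map f es)"
    unfolding xs f m_def by simp
  have len: "length xs = 2 + n + 5 * m"
    unfolding xs' m_def by (simp add: length_concat_uniform[OF len_f])
  have word: "input_word xs (n + 2 + 5 * j + i) = f (es ! j) ! i" if "j < m" "i < 5" for j i
  proof -
    have "n + 2 + 5 * j + i < length xs" using that len by simp
    then show ?thesis
      using nth_concat_uniform[OF len_f, of j es i] that
      unfolding input_word_def by (simp add: xs' m_def nth_append nth_Cons')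
  qed
  have bits_pos: "1 \<le> bits k" for k by (simp add: bits_def)
  have "length ys \<le> (\<Sum>y\<leftarrow>ys. bits y)" for ys
  proof (induction ys)
    case (Cons y ys)
    then show ?case using bits_pos[of y] by simp
  qed simp
  from this[of xs] have nm: "2 + n + 5 * m \<le> S"
    unfolding S_def input_size_def len by simp
  have inp: "input_word xs i < 2 ^ S" for i
  proof (cases "i < length xs")
    case True
    then have "bits (xs ! i) \<le> S"
      unfolding S_def input_size_def by (intro member_le_sum_list) auto
    then have "(2::nat) ^ bits (xs ! i) \<le> 2 ^ S" by simp
    with less_two_power_bits[of "xs ! i"] True show ?thesis
      unfolding input_word_def by (simp del: power_increasing_iff)
  qed (simp add: input_word_def)
  have pow: "x < 2 ^ L" if "x < 2 ^ k" "k \<le> L" for x k :: nat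
    using that by (meson less_le_trans one_le_numeral power_increasing)
  have arc: "es ! j \<in> parcs D" if "j < m" for j
    using es(2) that by (auto simp: m_def)
  have den_pos: "0 < den j" if "j < m" for j
    using ab[OF arc[OF that]] by (simp add: den_def)
  have B_pos: "0 < B" unfolding B_def using den_pos by (intro prod_pos) auto
  have B_le: "B \<le> 2 ^ S"
  proof -
    have "B = prod_list (map b es)"
      unfolding B_def den_def m_def by (simp add: prod.list_conv_set_nth atLeast0LessThan)
    also have "\<dots> \<le> 2 ^ (\<Sum>y\<leftarrow>map b es. bits y)" by (rule prod_list_le_power_bits)
    \<comment> \<open>The denominators are among the words of the input.\<close>
    also have "(\<Sum>y\<leftarrow>map b es. bits y) \<le> (\<Sum>y\<leftarrow>concat (map f es). bits y)"
      by (induction es) (auto simp: f_def)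
    then have "(2::nat) ^ (\<Sum>y\<leftarrow>map b es. bits y) \<le> 2 ^ S"
      unfolding S_def input_size_def xs' by (intro power_increasing) auto
    finally show ?thesis .
  qed
  have num: "num j * (B div den j) < 2 ^ (2 * S)" if "j < m" for j
  proof -
    have "num j < 2 ^ S" using inp[of "n + 2 + 5 * j + 3"] word[OF that, of 3]
      by (simp add: f_def num_def)
    moreover have "B div den j \<le> 2 ^ S" using B_le div_le_dividend le_trans by blast
    ultimately have "num j * (B div den j) < 2 ^ S * 2 ^ S"
      by (metis le_less_trans mult_le_mono2 mult_less_mono1 zero_less_numeral zero_less_power)
    then show ?thesis by (simp add: mult_2 power_add)
  qed
  have total: "(n + 4 * T + 1) * (\<Sum>j<m. wt j) < 2 ^ L"
  proof -
    have "(\<Sum>j<m. wt j) \<le> (\<Sum>j<m. 2 ^ (2 * S))"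
      using num by (intro sum_mono) (auto simp: wt_def less_imp_le)
    then have "(n + 4 * T + 1) * (\<Sum>j<m. wt j) \<le> (n + 4 * T + 1) * (m * 2 ^ (2 * S))"
      by (intro mult_le_mono2) simp
    also have "\<dots> \<le> 2 ^ (S + 4 * T + 1) * (2 ^ S * 2 ^ (2 * S))"
    proof (intro mult_le_mono order.refl)
      have "n + 4 * T + 1 \<le> S + 4 * T + 1" using nm by simp
      then show "n + 4 * T + 1 \<le> 2 ^ (S + 4 * T + 1)"
        using less_exp[of "S + 4 * T + 1"] by linarith
      show "m \<le> 2 ^ S" using nm less_exp[of S] by linarith
    qed
    also have "\<dots> = 2 ^ (S + 4 * T + 1 + (S + 2 * S))" by (simp only: power_add)
    also have "\<dots> < 2 ^ L" by (rule power_strict_increasing) (auto simp: L_def)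
    finally show ?thesis .
  qed
  have fin: "pair_fin_digraph D" and lA: "\<And>e. e \<in> parcs D \<Longrightarrow> lA e \<in> {1..T}"
    using inst by (auto simp: gmd_instance_def)
  interpret D: pair_fin_digraph D by (fact fin)
  have wf: "fst e < n \<and> snd e < n" if "e \<in> parcs D" for e
    using D.in_arcsD1 D.in_arcsD2 that verts by (metis lessThan_iff prod.collapse)
  interpret labelled_arcs n m T src dst lab wt
    using wf[OF arc] lA[OF arc] T
    by unfold_locales (auto simp: src_def dst_def lab_def wt_def)
  interpret gmd_run n m T src dst lab wt xs L num den B
  proof unfold_locales
    show "0 < L" by (simp add: L_def)
    show "input_word xs i < 2 ^ L" for i by (rule pow[OF inp]) (simp add: L_def)
    show "input_word xs 0 = n" "input_word xs 1 = m"
      unfolding input_word_def len by (simp_all add: xs')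
    show "input_word xs (n + 2 + 5 * j) = src j \<and>
      input_word xs (n + 3 + 5 * j) = dst j \<and> input_word xs (n + 4 + 5 * j) = lab j \<and>
      input_word xs (n + 5 + 5 * j) = num j \<and> input_word xs (n + 6 + 5 * j) = den j" if "j < m" for j
    proof -
      have shift: "n + 2 + 5 * j + 0 = n + 2 + 5 * j" "n + 2 + 5 * j + 1 = n + 3 + 5 * j"
        "n + 2 + 5 * j + 2 = n + 4 + 5 * j" "n + 2 + 5 * j + 3 = n + 5 + 5 * j"
        "n + 2 + 5 * j + 4 = n + 6 + 5 * j" by simp_all
      show ?thesis
        using word[OF that, of 0] word[OF that, of 1] word[OF that, of 2] word[OF that, of 3]
          word[OF that, of 4]
        unfolding shift by (simp add: f_def src_def dst_def lab_def num_def den_def)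
    qed
    show "wt j = (if src j = dst j then 0 else num j * (B div den j))" for j
      by (rule wt_def)
    show "0 < den j" if "j < m" for j by (fact den_pos[OF that])
    show "B = (\<Prod>j<m. den j)" by (rule B_def)
    have "2 * n + 5 * m + 4 * T + 64 \<le> L" using nm by (simp add: L_def)
    then show "2 * n + 5 * m + 4 * T + 64 < 2 ^ L" using less_exp[of L] by linarith
    show "B < 2 ^ L"
    proof (rule pow)
      show "B < 2 ^ Suc S" using B_le B_pos by simp
    qed (simp add: L_def)
    show "num j * (B div den j) < 2 ^ L" if "j < m" for j
      by (rule pow[OF num[OF that]]) (simp add: L_def)
    show "(n + 4 * T + 1) * labelled_arcs.total m wt < 2 ^ L"
      using total by (simp add: total_def)
  qed
  have small: "small_com (2 ^ L) (gmd_com T)"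
    using size_lt by (intro small_gmd_com) simp
  have "bounded (\<lambda>_. 0)" by (simp add: bounded_def)
  with wp_gmd small obtain t s k where run: "exec xs (gmd_com T) (\<lambda>_. 0) t s"
    and t: "t \<le> total_steps * (9 * L)"
    and s: "s 0 = 32" "\<And>u. u < n \<Longrightarrow> s (32 + u) \<le> T" and k: "n < 2 ^ k"
      "\<And>r. r \<le> 2 ^ k \<Longrightarrow> candidate_value (2 ^ k) r \<le> value_of (\<lambda>u. s (32 + u))"
    unfolding wp_def by blast
  have out: "output_labeling s = (\<lambda>u. s (32 + u))"
    by (simp add: output_labeling_def s(1) fun_eq_iff)
  \<comment> \<open>Multiplication by \<open>B\<close> clears all denominators, so the integer
    objective is a fixed positive multiple of the real one and the ratio carries over.\<close>
  have scale: "real (value_of lv) = real B * labeling_value D lA w lv" for lv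
  proof -
    have "labeling_value D lA w lv = (\<Sum>e\<in>parcs D. if satisfied lA lv e then w e else 0)"
      unfolding labeling_value_def by (intro sum.mono_neutral_cong_left) auto
    also have "\<dots> = (\<Sum>j<m. if satisfied lA lv (es ! j) then w (es ! j) else 0)"
      unfolding m_def
      by (rule sum.reindex_bij_betw[OF bij_betw_nth[OF es(1) refl es(2)[symmetric]], symmetric])
    also have "real B * \<dots> = (\<Sum>j<m. real (if lv (src j) = 0 \<and> lv (dst j) = lab j then wt j else 0))"
      unfolding sum_distrib_left
    proof (intro sum.cong refl)
      fix j assume "j \<in> {..<m}"
      then have j: "j < m" by simp
      have sat: "satisfied lA lv (es ! j) \<longleftrightarrow> lv (src j) = 0 \<and> lv (dst j) = lab j"
        by (simp add: satisfied_def src_def dst_def lab_def case_prod_beta)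
      show "real B * (if satisfied lA lv (es ! j) then w (es ! j) else 0) =
          real (if lv (src j) = 0 \<and> lv (dst j) = lab j then wt j else 0)"
      proof (cases "satisfied lA lv (es ! j)")
        case True
        \<comment> \<open>A satisfied arc has tail label 0 and head label at least 1, so giving
          loops weight 0 changes no value.\<close>
        then have "src j \<noteq> dst j" using sat lab_ge[OF j] by auto
        moreover have "den j dvd B" unfolding B_def using j by (intro dvd_prodI) auto
        ultimately have "real (wt j) = real (num j) * (real B / real (den j))"
          by (simp add: wt_def real_of_nat_div)
        then show ?thesis using True sat ab[OF arc[OF j]] by (simp add: num_def den_def)
      qed (use sat in auto)
    qed
    finally show ?thesis by (simp add: value_of_def)
  qed
  show ?thesis
  proof (rule that[OF run])
    have "T * (30 * m + 9) \<le> T * (30 * S + 9)" using nm by (intro mult_le_mono2) simp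
    then have "2 * (T * (30 * m + 9)) + 30 * m + 11 * n + 35 \<le> 2 * (T * (30 * S + 9)) + 41 * S + 35"
      using nm by linarith
    then have "n * (2 * (T * (30 * m + 9)) + 30 * m + 11 * n + 35) \<le>
        S * (2 * (T * (30 * S + 9)) + 41 * S + 35)"
      using nm by (intro mult_le_mono) simp
    then have "try_steps \<le> S * (2 * (T * (30 * S + 9)) + 41 * S + 35) + 6"
      unfolding try_steps_def by simp
    then have "(2 * n + 3) * (try_steps + 5) \<le>
        (2 * S + 3) * (S * (2 * (T * (30 * S + 9)) + 41 * S + 35) + 11)"
      using nm by (intro mult_le_mono) auto
    then have "total_steps \<le>
        7 * S + (2 * S + 3) * (S * (2 * (T * (30 * S + 9)) + 41 * S + 35) + 11) + 20"
      unfolding total_steps_def using nm by linarith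
    then have "total_steps * (9 * L) \<le>
        (7 * S + (2 * S + 3) * (S * (2 * (T * (30 * S + 9)) + 41 * S + 35) + 11) + 20) * (9 * L)"
      by (rule mult_le_mono1)
    with t show "t \<le> (let S = input_size xs in
       (7 * S + (2 * S + 3) * (S * (2 * (T * (30 * S + 9)) + 41 * S + 35) + 11) + 20) *
       (9 * (8 * S + 4 * T + 64)))"
      unfolding Let_def S_def[symmetric] L_def by (rule le_trans)
    show "output_labeling s \<in> labelings T D"
      using s(2) verts by (auto simp: out labelings_def)
    obtain lv where lv: "lv \<in> labelings T D" "labeling_value D lA w lv = gmd_opt T D lA w"
      using gmd_opt_attained(1)[OF inst] by blast
    have "lv v \<le> T" if "v < n" for v using lv(1) that verts by (auto simp: labelings_def)
    then obtain r where "r \<le> 2 ^ k"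
      "(1/4 + (1/128) / real T) * real (value_of lv) \<le> real (candidate_value (2 ^ k) r)"
      using exists_good_candidate[of lv "2 ^ k" k] k(1) by blast
    then have "(1/4 + (1/128) / real T) * real (value_of lv) \<le> real (value_of (\<lambda>u. s (32 + u)))"
      using k(2) by (meson of_nat_mono order_trans)
    then have "real B * ((1/4 + (1/128) / real T) * gmd_opt T D lA w) \<le>
        real B * labeling_value D lA w (output_labeling s)"
      unfolding scale lv(2) out by (simp add: mult_ac)
    then show "(1/4 + (1/128) / real T) * gmd_opt T D lA w \<le> labeling_value D lA w (output_labeling s)"
      using B_pos by simp
  qed
qed

theorem theorem6:
  shows "\<exists>c::real. c > 0 \<and>
    (\<forall>T::nat. T \<ge> 1 \<longrightarrow> (\<exists>prog. poly_time_approx_algorithm T (1/4 + c / real T) prog))"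
proof (intro exI[of _ "1/128 :: real"] conjI allI impI)
  fix T :: nat assume T: "1 \<le> T"
  define X :: "nat poly" where "X = [:0, 1:]"
  \<comment> \<open>\<open>X\<close> stands for the input size, while \<open>T\<close> is fixed and
    enters as a constant polynomial.\<close>
  define p where "p = (7 * X + (2 * X + 3) * (X * (2 * ([:T:] * (30 * X + 9)) + 41 * X + 35) + 11) + 20) *
       (9 * (8 * X + 4 * [:T:] + 64))"
  have p: "poly p S = (7 * S + (2 * S + 3) * (S * (2 * (T * (30 * S + 9)) + 41 * S + 35) + 11) + 20) *
       (9 * (8 * S + 4 * T + 64))" for S
    by (simp add: p_def X_def algebra_simps)
  show "\<exists>prog. poly_time_approx_algorithm T (1/4 + (1/128) / real T) prog"
    unfolding poly_time_approx_algorithm_def halts_in_poly_time_def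
  proof (intro exI[of _ "gmd_com T"] conjI exI[of _ p] ballI allI impI)
    fix xs assume "xs \<in> {xs. \<exists>D lA w. gmd_instance T D lA w \<and> encodes xs D lA w}"
    then obtain D lA w where "gmd_instance T D lA w" "encodes xs D lA w" by blast
    from gmd_com_correct[OF this T] show
      "\<exists>t s. exec xs (gmd_com T) (\<lambda>_. 0) t s \<and> t \<le> poly p (input_size xs)"
      unfolding p Let_def by metis
  next
    fix D lA w xs t s
    assume "gmd_instance T D lA w" "encodes xs D lA w" and run: "exec xs (gmd_com T) (\<lambda>_. 0) t s"
    from gmd_com_correct[OF this(1,2) T] obtain t' s' where
      "exec xs (gmd_com T) (\<lambda>_. 0) t' s'" "output_labeling s' \<in> labelings T D"
      "(1/4 + (1/128) / real T) * gmd_opt T D lA w \<le> labeling_value D lA w (output_labeling s')"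
      by metis
    \<comment> \<open>The guarantee concerns every halting run; determinism identifies it with the
      run already constructed.\<close>
    moreover from exec_deterministic[OF run this(1)] have "s' = s" by simp
    ultimately show "output_labeling s \<in> labelings T D"
      "(1/4 + (1/128) / real T) * gmd_opt T D lA w \<le> labeling_value D lA w (output_labeling s)"
      by simp_all
  qed
qed simp

end
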